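(* Let $Q\in\mathbb{S}^{n,n+m}$ be the data-dependent matrix defined in the context. Assume that $\phi<0$ and that $\begin{bmatrix}X_-\\ U_-\end{bmatrix}$ has full row rank. The data $\mathcal{D}=(U_-,X)$ are informative for quadratic stabilizability if and only if there exist a matrix $P>0$ (of size $n\times n$) and scalars $\alpha\ge0$ and $\beta>0$ such that $$\begin{bmatrix}P-\beta I&0&0\\ 0&-P&0\\ 0&0&I\end{bmatrix}-\alpha Q\ge0.$$
   Context: Notation. All matrices are real. $\mathbb{S}^n$: symmetric $n\times n$ matrices; $\ge,>,\le,<$ between symmetric matrices refer to (semi)definiteness. $\mathbb{S}^{p,q}$: symmetric $(p+q)\times(p+q)$ matrices partitioned as $\Pi=\begin{bmatrix}\Pi_{11}&\Pi_{12}\\ \Pi_{21}&\Pi_{22}\end{bmatrix}$ with $\Pi_{11}\in\mathbb{S}^p$, $\Pi_{22}\in\mathbb{S}^q$. $Y^\dagger$ is the Moore-Penrose pseudoinverse, $\otimes$ the Kronecker product, $\operatorname{vec}(Y)$ the column-stacking vectorization. $\Pi|\Pi_{22}:=\Pi_{11}-\Pi_{12}\Pi_{22}^{\dagger}\Pi_{21}$, and $\mathbf{\Pi}_{p,q}:=\{\Pi\in\mathbb{S}^{p,q}\mid \Pi_{22}\le 0,\ \ker\Pi_{22}\subseteq\ker\Pi_{12},\ \Pi|\Pi_{22}\ge 0\}$. Data and noise model. Let $n,m,T$ be positive integers. The data $\mathcal{D}=(U_-,X)$ consist of $U_-=[u(0)\ \cdots\ u(T-1)]\in\mathbb{R}^{m\times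 T}$ and $X=[x(0)\ \cdots\ x(T)]\in\mathbb{R}^{n\times(T+1)}$; put $X_-=[x(0)\ \cdots\ x(T-1)]$, $X_+=[x(1)\ \cdots\ x(T)]$. Let $\Phi\in\mathbf{\Pi}_{1,nT}$ be given, with $\Phi_{22}=\phi\otimes I_n$ for some $\phi\in\mathbb{S}^T$, and let $$\mathcal{W}_{\mathrm F}(\Phi):=\Big\{W\in\mathbb{R}^{n\times T}\ \Big|\ \begin{bmatrix}1\\ \operatorname{vec}(W)\end{bmatrix}^{\top}\Phi\begin{bmatrix}1\\ \operatorname{vec}(W)\end{bmatrix}\ge 0\Big\}.$$ The set of data-compatible systems is $\Sigma_{\mathcal D}(\mathcal{W}_{\mathrm F}(\Phi)):=\{(A,B)\in\mathbb{R}^{n\times n}\times\mathbb{R}^{n\times m}\mid X_+=AX_-+BU_-+W\text{ for some }W\in\mathcal{W}_{\mathrm F}(\Phi)\}$. The data are generated by a true (unknown) system $(A_s,B_s)$ with noise matrix in $\mathcal{W}_{\mathrm F}(\Phi)$, i.e. $(A_s,B_s)\in\Sigma_{\mathcal D}(\mathcal{W}_{\mathrm F}(\Phi))$. Informativity. The data are informative for quadratic stabilizability if there exists a real $n\times n$ matrix $P>0$ such that $$\begin{bmatrix}I\\ A^\top\\ B^\top\end{bmatrix}^{\top}\begin{bmatrix}P&0&0\\ 0&-P&0\\ 0&0&I\end{bmatrix}\begin{bmatrix}I\\ A^\top\\ B^\top\end{bmatrix}>0\quad\text{for all }(A,B)\in\Sigma_{\mathcal D}(\mathcal{W}_{\mathrm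 F}(\Phi)).$$ The matrices $N$ and $Q$. Let $$E:=\begin{bmatrix}1&0\\ \operatorname{vec}(X_+)&-\begin{bmatrix}X_-\\ U_-\end{bmatrix}^{\top}\otimes I_n\end{bmatrix},\qquad N:=E^{\top}\Phi E\in\mathbb{S}^{1,n(n+m)},$$ $$Q_{22}:=\begin{bmatrix}X_-\\ U_-\end{bmatrix}\phi\begin{bmatrix}X_-\\ U_-\end{bmatrix}^{\top},\qquad Q:=\begin{bmatrix}(N|N_{22})I_n+Q_{12}Q_{22}^{\dagger}Q_{21}&Q_{12}\\ Q_{21}&Q_{22}\end{bmatrix}\in\mathbb{S}^{n,n+m},$$ where $Q_{12}\in\mathbb{R}^{n\times(n+m)}$ is determined by $\operatorname{vec}(Q_{12})=N_{21}$ and $Q_{21}=Q_{12}^\top$. *)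

theory Defs
  imports
    "Jordan_Normal_Form.Matrix"
    "Jordan_Normal_Form.Matrix_Kernel"
    "Jordan_Normal_Form.DL_Rank"
begin

section \<open>Matrix notions\<close>

definition sym_mats :: "nat \<Rightarrow> real mat set" where
  "sym_mats n = {A \<in> carrier_mat n n. A\<^sup>T = A}"

text \<open>Definiteness refers to symmetric matrices only, and the size is part of the predicate.
  For symmetric matrices, \<open>A \<le> 0\<close> and \<open>A < 0\<close> are rendered as \<open>psd n (- A)\<close> and \<open>pd n (- A)\<close>.\<close>

definition psd :: "nat \<Rightarrow> real mat \<Rightarrow> bool" where
  "psd n A \<longleftrightarrow> A \<in> sym_mats n \<and> (\<forall>v \<in> carrier_vec n. v \<bullet> (A *\<^sub>v v) \<ge> 0)"

definition pd :: "nat \<Rightarrow> real mat \<Rightarrow> bool" where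
  "pd n A \<longleftrightarrow> A \<in> sym_mats n \<and> (\<forall>v \<in> carrier_vec n. v \<noteq> 0\<^sub>v n \<longrightarrow> v \<bullet> (A *\<^sub>v v) > 0)"

definition is_pinv :: "real mat \<Rightarrow> real mat \<Rightarrow> bool" where
  "is_pinv A Y \<longleftrightarrow> Y \<in> carrier_mat (dim_col A) (dim_row A) \<and>
     A * Y * A = A \<and> Y * A * Y = Y \<and> (A * Y)\<^sup>T = A * Y \<and> (Y * A)\<^sup>T = Y * A"

text \<open>The Moore-Penrose pseudoinverse: the four Penrose conditions above have exactly one
  solution for every real matrix.\<close>

definition pinv :: "real mat \<Rightarrow> real mat" where
  "pinv A = (THE Y. is_pinv A Y)"

lemma is_pinv_unique:
  assumes Y: "is_pinv A Y" and Z: "is_pinv A Z"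
  shows "Y = Z"
proof -
  define r c where "r = dim_row A" and "c = dim_col A"
  have A: "A \<in> carrier_mat r c" by (auto simp: r_def c_def)
  have Yc: "Y \<in> carrier_mat c r" and Zc: "Z \<in> carrier_mat c r"
    using Y Z by (auto simp: is_pinv_def r_def c_def)
  have AY: "A * Y \<in> carrier_mat r r" and AZ: "A * Z \<in> carrier_mat r r"
    and YA: "Y * A \<in> carrier_mat c c" and ZA: "Z * A \<in> carrier_mat c c"
    using A Yc Zc by auto
  have "A * Y = (A * Z * A) * Y" using Z by (simp add: is_pinv_def)
  also have "\<dots> = (A * Z) * (A * Y)" using assoc_mult_mat[OF AZ A Yc] .
  also have "\<dots> = (A * Z)\<^sup>T * (A * Y)\<^sup>T" using Y Z by (simp add: is_pinv_def)
  also have "\<dots> = ((A * Y) * (A * Z))\<^sup>T" using transpose_mult[OF AY AZ] by simp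
  also have "(A * Y) * (A * Z) = (A * Y * A) * Z" using assoc_mult_mat[OF AY A Zc] by simp
  also have "\<dots>\<^sup>T = A * Z" using Y Z by (simp add: is_pinv_def)
  finally have 1: "A * Y = A * Z" .
  have "Y * A = Y * (A * Z * A)" using Z by (simp add: is_pinv_def)
  also have "A * Z * A = A * (Z * A)" using assoc_mult_mat[OF A Zc A] .
  also have "Y * (A * (Z * A)) = (Y * A) * (Z * A)" using assoc_mult_mat[OF Yc A ZA] by simp
  also have "\<dots> = (Y * A)\<^sup>T * (Z * A)\<^sup>T" using Y Z by (simp add: is_pinv_def)
  also have "\<dots> = ((Z * A) * (Y * A))\<^sup>T" using transpose_mult[OF ZA YA] by simp
  also have "(Z * A) * (Y * A) = Z * (A * (Y * A))" using assoc_mult_mat[OF Zc A YA] .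
  also have "A * (Y * A) = A * Y * A" using assoc_mult_mat[OF A Yc A] by simp
  also have "(Z * (A * Y * A))\<^sup>T = Z * A" using Y Z by (simp add: is_pinv_def)
  finally have 2: "Y * A = Z * A" .
  have "Y = Y * A * Y" using Y by (simp add: is_pinv_def)
  also have "\<dots> = Z * A * Y" by (simp only: 2)
  also have "\<dots> = Z * (A * Y)" using assoc_mult_mat[OF Zc A Yc] .
  also have "\<dots> = Z * A * Z" unfolding 1 using assoc_mult_mat[OF Zc A Zc] by simp
  also have "\<dots> = Z" using Z by (simp add: is_pinv_def)
  finally show ?thesis .
qed

lemma pinv_eqI: "is_pinv A Y \<Longrightarrow> pinv A = Y"
  unfolding pinv_def by (blast intro: the_equality is_pinv_unique)

definition kron :: "real mat \<Rightarrow> real mat \<Rightarrow> real mat" where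
  "kron A B = mat (dim_row A * dim_row B) (dim_col A * dim_col B)
     (\<lambda>(i, j). A $$ (i div dim_row B, j div dim_col B) * B $$ (i mod dim_row B, j mod dim_col B))"

text \<open>Column stacking \<open>vec\<close> and its inverse on matrices of a given size.\<close>

definition vectorize :: "real mat \<Rightarrow> real vec" where
  "vectorize A = vec (dim_row A * dim_col A) (\<lambda>k. A $$ (k mod dim_row A, k div dim_row A))"

definition unvectorize :: "nat \<Rightarrow> nat \<Rightarrow> real vec \<Rightarrow> real mat" where
  "unvectorize r c v = mat r c (\<lambda>(i, j). v $ (j * r + i))"

lemma vectorize_unvectorize:
  assumes "v \<in> carrier_vec (r * c)"
  shows "vectorize (unvectorize r c v) = v"
proof (rule eq_vecI)
  fix k assume "k < dim_vec v"
  then have k: "k < r * c" using assms by simp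
  then have "r > 0" by (cases r) auto
  moreover have "k div r < c" using k by (simp add: less_mult_imp_div_less mult.commute)
  ultimately show "vectorize (unvectorize r c v) $ k = v $ k"
    using k by (simp add: vectorize_def unvectorize_def)
qed (use assms in \<open>auto simp: vectorize_def unvectorize_def\<close>)

text \<open>The blocks of a square matrix whose \<open>(1,1)\<close> block has size \<open>p \<times> p\<close>.\<close>

definition blk11 :: "nat \<Rightarrow> real mat \<Rightarrow> real mat" where
  "blk11 p M = (case split_block M p p of (A, B, C, D) \<Rightarrow> A)"

definition blk12 :: "nat \<Rightarrow> real mat \<Rightarrow> real mat" where
  "blk12 p M = (case split_block M p p of (A, B, C, D) \<Rightarrow> B)"

definition blk21 :: "nat \<Rightarrow> real mat \<Rightarrow> real mat" where
  "blk21 p M = (case split_block M p p of (A, B, C, D) \<Rightarrow> C)"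

definition blk22 :: "nat \<Rightarrow> real mat \<Rightarrow> real mat" where
  "blk22 p M = (case split_block M p p of (A, B, C, D) \<Rightarrow> D)"

text \<open>The generalized Schur complement \<open>\<Pi>|\<Pi>\<^sub>2\<^sub>2\<close>.\<close>

definition schur_compl :: "nat \<Rightarrow> real mat \<Rightarrow> real mat" where
  "schur_compl p M = blk11 p M - blk12 p M * pinv (blk22 p M) * blk21 p M"

definition Pi_set :: "nat \<Rightarrow> nat \<Rightarrow> real mat set" where
  "Pi_set p q = {M \<in> sym_mats (p + q).
     psd q (- blk22 p M) \<and>
     mat_kernel (blk22 p M) \<subseteq> mat_kernel (blk12 p M) \<and>
     psd p (schur_compl p M)}"


section \<open>Data, noise model and informativity\<close>

text \<open>The state data \<open>X = [x(0) \<dots> x(T)]\<close> has \<open>T + 1\<close> columns.\<close>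

definition X_minus :: "real mat \<Rightarrow> real mat" where
  "X_minus X = mat (dim_row X) (dim_col X - 1) (\<lambda>(i, j). X $$ (i, j))"

definition X_plus :: "real mat \<Rightarrow> real mat" where
  "X_plus X = mat (dim_row X) (dim_col X - 1) (\<lambda>(i, j). X $$ (i, j + 1))"

definition data_stack :: "real mat \<Rightarrow> real mat \<Rightarrow> real mat" where
  "data_stack U X = X_minus X @\<^sub>r U"

definition W_F :: "nat \<Rightarrow> nat \<Rightarrow> real mat \<Rightarrow> real mat set" where
  "W_F n T \<Phi> = {W \<in> carrier_mat n T.
     vCons 1 (vectorize W) \<bullet> (\<Phi> *\<^sub>v vCons 1 (vectorize W)) \<ge> 0}"

definition Sigma_D :: "nat \<Rightarrow> nat \<Rightarrow> nat \<Rightarrow> real mat \<Rightarrow> real mat \<Rightarrow> real mat \<Rightarrow> (real mat \<times> real mat) set" where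
  "Sigma_D n m T U X \<Phi> = {(A, B). A \<in> carrier_mat n n \<and> B \<in> carrier_mat n m \<and>
     (\<exists>W \<in> W_F n T \<Phi>. X_plus X = A * X_minus X + B * U + W)}"

definition informative_quad_stab :: "nat \<Rightarrow> nat \<Rightarrow> nat \<Rightarrow> real mat \<Rightarrow> real mat \<Rightarrow> real mat \<Rightarrow> bool" where
  "informative_quad_stab n m T U X \<Phi> \<longleftrightarrow>
     (\<exists>P. pd n P \<and>
        (\<forall>(A, B) \<in> Sigma_D n m T U X \<Phi>.
           pd n ((1\<^sub>m n @\<^sub>r A\<^sup>T @\<^sub>r B\<^sup>T)\<^sup>T * diag_block_mat [P, - P, 1\<^sub>m m] *
                 (1\<^sub>m n @\<^sub>r A\<^sup>T @\<^sub>r B\<^sup>T))))"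


section \<open>The matrices \<open>N\<close> and \<open>Q\<close>\<close>

definition E_mat :: "nat \<Rightarrow> nat \<Rightarrow> nat \<Rightarrow> real mat \<Rightarrow> real mat \<Rightarrow> real mat" where
  "E_mat n m T U X = four_block_mat
     (1\<^sub>m 1) (0\<^sub>m 1 (n * (n + m)))
     (mat_of_cols (n * T) [vectorize (X_plus X)]) (- kron ((data_stack U X)\<^sup>T) (1\<^sub>m n))"

definition N_mat :: "nat \<Rightarrow> nat \<Rightarrow> nat \<Rightarrow> real mat \<Rightarrow> real mat \<Rightarrow> real mat \<Rightarrow> real mat" where
  "N_mat n m T U X \<Phi> = (E_mat n m T U X)\<^sup>T * \<Phi> * E_mat n m T U X"

text \<open>\<open>N\<^sub>2\<^sub>1\<close> is a single column and \<open>N|N\<^sub>2\<^sub>2\<close> is a \<open>1 \<times> 1\<close> matrix, used below as a scalar.\<close>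

definition Q12 :: "nat \<Rightarrow> nat \<Rightarrow> nat \<Rightarrow> real mat \<Rightarrow> real mat \<Rightarrow> real mat \<Rightarrow> real mat" where
  "Q12 n m T U X \<Phi> = unvectorize n (n + m) (col (blk21 1 (N_mat n m T U X \<Phi>)) 0)"

lemma vectorize_Q12:
  assumes "U \<in> carrier_mat m T" "X \<in> carrier_mat n (T + 1)"
  shows "vectorize (Q12 n m T U X \<Phi>) = col (blk21 1 (N_mat n m T U X \<Phi>)) 0"
  unfolding Q12_def
  by (rule vectorize_unvectorize, rule carrier_vecI)
    (use assms in \<open>simp add: blk21_def split_block_def Let_def N_mat_def E_mat_def kron_def
      data_stack_def append_rows_def X_minus_def algebra_simps\<close>)

definition Q22 :: "real mat \<Rightarrow> real mat \<Rightarrow> real mat \<Rightarrow> real mat" where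
  "Q22 U X \<phi> = data_stack U X * \<phi> * (data_stack U X)\<^sup>T"

definition Q_mat :: "nat \<Rightarrow> nat \<Rightarrow> nat \<Rightarrow> real mat \<Rightarrow> real mat \<Rightarrow> real mat \<Rightarrow> real mat \<Rightarrow> real mat" where
  "Q_mat n m T U X \<Phi> \<phi> =
     (let Q12 = Q12 n m T U X \<Phi>; Q21 = Q12\<^sup>T; Q22 = Q22 U X \<phi>
      in four_block_mat
           ((schur_compl 1 (N_mat n m T U X \<Phi>) $$ (0, 0)) \<cdot>\<^sub>m 1\<^sub>m n + Q12 * pinv Q22 * Q21) Q12
           Q21 Q22)"

end

theory Submission
  imports "HOL-Analysis.Function_Topology" Defs
begin

text \<open>Completing the square in \<open>N\<close> shows that the compatible systems \<open>K = [A B]\<close> are those with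
  \<open>tr ((K + Z) (- Q\<^sub>2\<^sub>2) (K + Z)\<^sup>T) \<le> s\<close>, where \<open>s = N|N\<^sub>2\<^sub>2\<close> and \<open>Z = Q\<^sub>1\<^sub>2 Q\<^sub>2\<^sub>2\<^sup>-\<^sup>1\<close>: a weighted Frobenius ball.
  The form of \<open>Q\<close> is \<open>s |v|\<^sup>2 + (y + Z\<^sup>T v)\<^sup>T Q\<^sub>2\<^sub>2 (y + Z\<^sup>T v)\<close>, and it describes the corresponding
  spectral ball. For a single direction \<open>v \<noteq> 0\<close> the two balls have the same image \<open>K\<^sup>T v\<close>, because
  the extremal \<open>K + Z\<close> can be taken of rank one. Hence informativity says that the form of
  \<open>diag(P, -P, I)\<close> is positive at every nonzero \<open>(v, y)\<close> where the form of \<open>Q\<close> is nonnegative, and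
  a strict S-lemma turns this into the matrix inequality.\<close>

section \<open>Quadratic forms and the strict S-lemma\<close>

definition qform :: "real mat \<Rightarrow> real vec \<Rightarrow> real" where
  "qform M x = x \<bullet> (M *\<^sub>v x)"

lemma qform_vec:
  assumes "M \<in> carrier_mat N N"
  shows "qform M (vec N u) = (\<Sum>i<N. u i * (\<Sum>j<N. M $$ (i, j) * u j))"
  using assms
  by (auto simp: qform_def scalar_prod_def atLeast0LessThan intro!: sum.cong)

lemma qform_add_smult:
  assumes M: "M \<in> carrier_mat N N" and x: "x \<in> carrier_vec N" and y: "y \<in> carrier_vec N"
  shows "qform M (x + t \<cdot>\<^sub>v y) =
    qform M x + t * (x \<bullet> (M *\<^sub>v y) + y \<bullet> (M *\<^sub>v x)) + t\<^sup>2 * qform M y"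
proof -
  have Mx: "M *\<^sub>v x \<in> carrier_vec N" "M *\<^sub>v y \<in> carrier_vec N" using M x y by auto
  have "M *\<^sub>v (x + t \<cdot>\<^sub>v y) = M *\<^sub>v x + t \<cdot>\<^sub>v (M *\<^sub>v y)"
    using M x y by (simp add: mult_add_distrib_mat_vec mult_mat_vec)
  then show ?thesis using Mx x y
    by (simp add: qform_def scalar_prod_add_distrib[of _ N] add_scalar_prod_distrib[of _ N]
        algebra_simps power2_eq_square)
qed

lemma qform_smult:
  assumes M: "M \<in> carrier_mat N N" and x: "x \<in> carrier_vec N"
  shows "qform M (t \<cdot>\<^sub>v x) = t\<^sup>2 * qform M x"
  using assms by (simp add: qform_def mult_mat_vec power2_eq_square)

lemma qform_zero: "M \<in> carrier_mat N N \<Longrightarrow> qform M (0\<^sub>v N) = 0"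
  by (simp add: qform_def)

lemma qform_one: "x \<in> carrier_vec N \<Longrightarrow> qform (1\<^sub>m N) x = x \<bullet> x"
  by (simp add: qform_def)

lemma qform_add:
  assumes "M \<in> carrier_mat N N" "G \<in> carrier_mat N N" "x \<in> carrier_vec N"
  shows "qform (M + G) x = qform M x + qform G x"
  using assms by (simp add: qform_def add_mult_distrib_mat_vec[of _ N N] scalar_prod_add_distrib[of _ N])

lemma qform_smult_mat:
  assumes "M \<in> carrier_mat N N" "x \<in> carrier_vec N"
  shows "qform (c \<cdot>\<^sub>m M) x = c * qform M x"
proof -
  have "(c \<cdot>\<^sub>m M) *\<^sub>v x = c \<cdot>\<^sub>v (M *\<^sub>v x)" using assms by auto
  then show ?thesis using assms by (simp add: qform_def)
qed

lemma qform_minus: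
  assumes "M \<in> carrier_mat N N" "G \<in> carrier_mat N N" "x \<in> carrier_vec N"
  shows "qform (M - G) x = qform M x - qform G x"
  using assms by (simp add: qform_def minus_mult_distrib_mat_vec[of _ N N] scalar_prod_minus_distrib[of _ N])

lemma qform_uminus:
  assumes "M \<in> carrier_mat N N" "x \<in> carrier_vec N"
  shows "qform (- M) x = - qform M x"
proof -
  have "- M = (-1) \<cdot>\<^sub>m M" by auto
  then show ?thesis using qform_smult_mat[OF assms, of "-1"] by simp
qed

lemma scalar_prod_self_pos:
  assumes "x \<in> carrier_vec N" "x \<noteq> 0\<^sub>v N"
  shows "x \<bullet> x > (0::real)"
proof -
  have "x \<bullet> x = (\<Sum>i<N. (x $ i)\<^sup>2)"
    using assms by (simp add: scalar_prod_def atLeast0LessThan power2_eq_square)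
  moreover have "\<exists>i<N. x $ i \<noteq> 0"
    using assms by (metis eq_vecI carrier_vecD index_zero_vec)
  ultimately show ?thesis by (auto intro!: sum_pos2)
qed

section \<open>The strict S-lemma: compactness gap, separation of multipliers, perturbation\<close>

text \<open>The maximum of \<open>qform M\<close> and \<open>- qform G\<close> is continuous and
  positive on the unit sphere, so compactness bounds it below by some \<delta> > 0. Both forms are
  homogeneous of degree two, which carries the bound to all vectors.\<close>

lemma qform_pair_gap:
  assumes M: "M \<in> carrier_mat N N" and G: "G \<in> carrier_mat N N"
    and pos: "\<And>x. x \<in> carrier_vec N \<Longrightarrow> x \<noteq> 0\<^sub>v N \<Longrightarrow> qform G x \<ge> 0 \<Longrightarrow> qform M x > 0"
  obtains \<delta> where "\<delta> > 0"
    "\<And>x. x \<in> carrier_vec N \<Longrightarrow> qform M x \<ge> \<delta> * (x \<bullet> x) \<or> qform G x \<le> - \<delta> * (x \<bullet> x)"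
proof -
  define F where "F = (\<lambda>M u. \<Sum>i<N. u i * (\<Sum>j<N. M $$ (i, j) * u j) :: real)"
  \<comment> \<open>The unit sphere, coded by functions on all naturals that vanish from index
    \<open>N\<close> on. The box is compact by Tychonoff, since every remaining coordinate is pinned
    to 0; the sphere is a closed subset of it.\<close>
  define S where "S = (\<Pi>\<^sub>E i\<in>UNIV. if i < N then {-1..1} else {0}) \<inter> {u. (\<Sum>i<N. (u i)\<^sup>2) = (1::real)}"
  have qF: "qform A (vec N u) = F A u" if "A \<in> carrier_mat N N" for A u
    using qform_vec[OF that] by (simp add: F_def)
  have coord: "continuous_on UNIV (\<lambda>u::nat \<Rightarrow> real. u i)" for i by simp
  have cF: "continuous_on UNIV (F A)" for A
    unfolding F_def by (intro continuous_intros coord)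
  have "compact (\<Pi>\<^sub>E i\<in>UNIV. if i < N then {-1..1} else {0::real})"
    using compactin_PiE[of "\<lambda>_. euclidean" "UNIV :: nat set" "\<lambda>i. if i < N then {-1..1} else {0::real}"]
    by (simp add: euclidean_product_topology)
  moreover have "closed {u::nat \<Rightarrow> real. (\<Sum>i<N. (u i)\<^sup>2) = 1}"
    by (intro closed_Collect_eq continuous_intros coord)
  ultimately have S: "compact S" unfolding S_def by (rule compact_Int_closed)
  define h where "h = (\<lambda>u. max (F M u) (- F G u))"
  have ch: "continuous_on S h"
    unfolding h_def by (rule continuous_on_subset[of UNIV]) (intro continuous_intros cF, simp)
  have hpos: "h u > 0" if "u \<in> S" for u
  proof -
    have "vec N u \<noteq> 0\<^sub>v N"
    proof
      assume "vec N u = 0\<^sub>v N"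
      then have "u i = 0" if "i < N" for i using that by (metis index_vec index_zero_vec(1))
      then have "(\<Sum>i<N. (u i)\<^sup>2) = 0" by simp
      then show False using that by (simp add: S_def)
    qed
    then show ?thesis using pos[of "vec N u"] qF[OF M] qF[OF G]
      by (force simp: h_def less_max_iff_disj)
  qed
  obtain \<delta> where \<delta>: "\<delta> > 0" "\<And>u. u \<in> S \<Longrightarrow> h u \<ge> \<delta>"
  \<comment> \<open>The sphere is empty when \<open>N = 0\<close>; any positive \<delta> then
    does.\<close>
  proof (cases "S = {}")
    case False
    with continuous_attains_inf[OF S _ ch] obtain u where "u \<in> S" "\<forall>v\<in>S. h u \<le> h v" by blast
    then show ?thesis using hpos that by blast
  qed (use that[of 1] in auto)
  show ?thesis
  proof (rule that[OF \<delta>(1)])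
    fix x :: "real vec" assume x: "x \<in> carrier_vec N"
    show "qform M x \<ge> \<delta> * (x \<bullet> x) \<or> qform G x \<le> - \<delta> * (x \<bullet> x)"
    proof (cases "x = 0\<^sub>v N")
      case True then show ?thesis using M by (simp add: qform_zero)
    next
      case False
      define r where "r = sqrt (x \<bullet> x)"
      have r: "r > 0" "r\<^sup>2 = x \<bullet> x" using scalar_prod_self_pos[OF x False] by (auto simp: r_def)
      define u where "u = (\<lambda>i. if i < N then x $ i / r else 0)"
      have xx: "x \<bullet> x = (\<Sum>i<N. (x $ i)\<^sup>2)"
        using x by (simp add: scalar_prod_def atLeast0LessThan power2_eq_square)
      have u1: "(\<Sum>i<N. (u i)\<^sup>2) = 1"
        using r(1) r(2)[symmetric] by (simp add: u_def power_divide xx flip: sum_divide_distrib)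
      have "\<bar>u i\<bar> \<le> 1" if "i < N" for i
      proof -
        have "(u i)\<^sup>2 \<le> (\<Sum>i<N. (u i)\<^sup>2)" by (rule member_le_sum) (use that in auto)
        then show ?thesis by (simp add: u1 abs_square_le_1)
      qed
      moreover have "u i = 0" if "\<not> i < N" for i using that by (simp add: u_def)
      ultimately have "u \<in> S" using u1 by (simp add: S_def PiE_iff abs_le_iff minus_le_iff)
      then have "\<delta> \<le> F M u \<or> F G u \<le> - \<delta>" using \<delta>(2)[of u] by (auto simp: h_def)
      then have "\<delta> * r\<^sup>2 \<le> F M u * r\<^sup>2 \<or> F G u * r\<^sup>2 \<le> - \<delta> * r\<^sup>2"
        by (meson mult_right_mono zero_le_power2)
      moreover have "x = r \<cdot>\<^sub>v vec N u" using x r by (auto simp: u_def)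
      then have "qform A x = F A u * r\<^sup>2" if "A \<in> carrier_mat N N" for A
        using qform_smult[OF that] qF[OF that] by simp
      ultimately show ?thesis using M G by (simp flip: r(2))
    qed
  qed
qed

lemma S_lemma_ratio:
  assumes M: "M \<in> carrier_mat N N" and G: "G \<in> carrier_mat N N"
    and pos: "\<And>x. x \<in> carrier_vec N \<Longrightarrow> x \<noteq> 0\<^sub>v N \<Longrightarrow> qform G x \<ge> 0 \<Longrightarrow> qform M x > 0"
    and x: "x \<in> carrier_vec N" "qform G x < 0" and y: "y \<in> carrier_vec N" "qform G y > 0"
  shows "qform M x / qform G x \<le> qform M y / qform G y"
proof -
  \<comment> \<open>Along \<open>x + t y\<close> the form of \<open>M - c G\<close> is affine in \<open>t\<close> and positive at the two roots of \<open>g\<close>,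
    which have opposite signs; hence it is positive at \<open>t = 0\<close>.\<close>
  define c where "c = qform M y / qform G y"
  define g where "g = (\<lambda>t. qform G (x + t \<cdot>\<^sub>v y))"
  define b where "b = x \<bullet> (G *\<^sub>v y) + y \<bullet> (G *\<^sub>v x)"
  define b' where "b' = x \<bullet> (M *\<^sub>v y) + y \<bullet> (M *\<^sub>v x)"
  have g: "g t = qform G x + t * b + t\<^sup>2 * qform G y" for t
    using qform_add_smult[OF G x(1) y(1)] by (simp add: g_def b_def)
  have M_at_root: "qform M x - c * qform G x + t * (b' - c * b) > 0" if "g t = 0" for t
  proof -
    have "x + t \<cdot>\<^sub>v y \<noteq> 0\<^sub>v N"
    proof
      assume 0: "x + t \<cdot>\<^sub>v y = 0\<^sub>v N"
      then have "x = (- t) \<cdot>\<^sub>v y"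
        using x(1) y(1) by (intro eq_vecI) (auto simp: vec_eq_iff add_eq_0_iff2)
      then have "qform G x = t\<^sup>2 * qform G y" using qform_smult[OF G y(1), of "- t"] by simp
      then show False using x(2) y(2) by (simp add: mult_less_0_iff)
    qed
    then have "qform M (x + t \<cdot>\<^sub>v y) - c * g t > 0"
      using pos[of "x + t \<cdot>\<^sub>v y"] that x(1) y(1) by (simp add: g_def)
    \<comment> \<open>This choice of \<open>c\<close> cancels the quadratic term in
      \<open>t\<close>.\<close>
    moreover have "qform M y = c * qform G y" using y by (simp add: c_def)
    ultimately show ?thesis
      unfolding g qform_add_smult[OF M x(1) y(1)] b'_def[symmetric] by (simp add: algebra_simps)
  qed
  define D where "D = b\<^sup>2 - 4 * qform G y * qform G x"
  have D: "D > b\<^sup>2" using x y by (simp add: D_def mult_less_0_iff)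
  then have sD: "sqrt D > \<bar>b\<bar>" by (metis real_sqrt_abs real_sqrt_less_iff)
  define t1 t2 where "t1 = (- b - sqrt D) / (2 * qform G y)" and "t2 = (- b + sqrt D) / (2 * qform G y)"
  have sq: "sqrt D * sqrt D = D" using D by (simp add: order.trans[OF zero_le_power2 less_imp_le])
  have "g t1 = 0" "g t2 = 0"
    using y sq by (simp_all add: g t1_def t2_def D_def field_simps power2_eq_square)
  note M1 = M_at_root[OF this(1)] and M2 = M_at_root[OF this(2)]
  have "t1 < 0" "t2 > 0" using sD y by (auto simp: t1_def t2_def field_simps)
  then have "qform M x - c * qform G x > 0"
  proof (cases "b' - c * b \<ge> 0")
    case True
    then have "t1 * (b' - c * b) \<le> 0" using \<open>t1 < 0\<close> by (simp add: mult_nonpos_nonneg)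
    then show ?thesis using M1 by linarith
  next
    case False
    then have "t2 * (b' - c * b) \<le> 0" using \<open>t2 > 0\<close> by (simp add: mult_nonneg_nonpos)
    then show ?thesis using M2 by linarith
  qed
  then show ?thesis using x(2) unfolding c_def[symmetric] by (simp add: neg_divide_le_eq)
qed

text \<open>A vector with negative \<open>qform G\<close> bounds \<alpha> from below by the ratio of
  the two forms, one with positive \<open>qform G\<close> bounds it from above. By
  \<open>S_lemma_ratio\<close> no lower bound exceeds an upper one, and \<open>y\<close> supplies an
  upper bound, so the supremum of the lower bounds meets every constraint.\<close>

lemma S_lemma:
  assumes M: "M \<in> carrier_mat N N" and G: "G \<in> carrier_mat N N"
    and pos: "\<And>x. x \<in> carrier_vec N \<Longrightarrow> x \<noteq> 0\<^sub>v N \<Longrightarrow> qform G x \<ge> 0 \<Longrightarrow> qform M x > 0"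
    and y: "y \<in> carrier_vec N" "qform G y > 0"
  obtains \<alpha> where "\<alpha> \<ge> 0" "\<And>x. x \<in> carrier_vec N \<Longrightarrow> qform M x \<ge> \<alpha> * qform G x"
proof -
  \<comment> \<open>The inserted 0 forces \<alpha> \<ge> 0 and keeps the set nonempty. It lies below
    all upper bounds because \<open>qform M\<close> is positive wherever \<open>qform G\<close>
    is.\<close>
  define Q where "Q = insert 0 {qform M x / qform G x | x. x \<in> carrier_vec N \<and> qform G x < 0}"
  have ub: "q \<le> qform M z / qform G z" if "q \<in> Q" "z \<in> carrier_vec N" "qform G z > 0" for q z
  proof -
    have "z \<noteq> 0\<^sub>v N" using that qform_zero[OF G] by auto
    then have "qform M z > 0" using pos that by simp
    then show ?thesis using that S_lemma_ratio[OF M G pos] by (auto simp: Q_def)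
  qed
  then have bdd: "bdd_above Q" using y by (meson bdd_above.I)
  show ?thesis
  proof (rule that[of "Sup Q"])
    show "Sup Q \<ge> 0" by (rule cSup_upper[OF _ bdd]) (simp add: Q_def)
    fix x :: "real vec" assume x: "x \<in> carrier_vec N"
    consider "qform G x < 0" | "qform G x = 0" | "qform G x > 0" by linarith
    then show "qform M x \<ge> Sup Q * qform G x"
    proof cases
      case 1
      then have "qform M x / qform G x \<le> Sup Q"
        by (intro cSup_upper[OF _ bdd]) (use x in \<open>auto simp: Q_def\<close>)
      then show ?thesis using 1 by (simp add: neg_divide_le_eq)
    next
      case 2
      then show ?thesis using pos[OF x] qform_zero[OF M] by (cases "x = 0\<^sub>v N") auto
    next
      case 3
      have "Sup Q \<le> qform M x / qform G x"
        by (rule cSup_least) (use ub x 3 in \<open>auto simp: Q_def\<close>)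
      then show ?thesis using 3 by (simp add: pos_le_divide_eq)
    qed
  qed
qed

text \<open>Half of the compactness gap is spent on shifting \<open>M\<close> down and
  \<open>G\<close> up by \<delta> times the identity. The positivity premise survives, and
  \<open>y\<close>, where the form of \<open>G\<close> may vanish, becomes a point where the shifted
  form is strictly positive, as \<open>S_lemma\<close> requires.\<close>

lemma strict_S_lemma:
  assumes M: "M \<in> carrier_mat N N" and G: "G \<in> carrier_mat N N"
    and pos: "\<And>x. x \<in> carrier_vec N \<Longrightarrow> x \<noteq> 0\<^sub>v N \<Longrightarrow> qform G x \<ge> 0 \<Longrightarrow> qform M x > 0"
    and y: "y \<in> carrier_vec N" "y \<noteq> 0\<^sub>v N" "qform G y \<ge> 0"
  obtains \<alpha> \<delta> where "\<alpha> \<ge> 0" "\<delta> > 0"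
    "\<And>x. x \<in> carrier_vec N \<Longrightarrow> qform M x - \<alpha> * qform G x \<ge> \<delta> * (x \<bullet> x)"
proof -
  obtain \<delta>' where \<delta>': "\<delta>' > 0"
    "\<And>x. x \<in> carrier_vec N \<Longrightarrow> qform M x \<ge> \<delta>' * (x \<bullet> x) \<or> qform G x \<le> - \<delta>' * (x \<bullet> x)"
    using qform_pair_gap[OF M G pos] by blast
  define \<delta> where "\<delta> = \<delta>' / 2"
  define M' G' where "M' = M - \<delta> \<cdot>\<^sub>m 1\<^sub>m N" and "G' = G + \<delta> \<cdot>\<^sub>m 1\<^sub>m N"
  have carr: "M' \<in> carrier_mat N N" "G' \<in> carrier_mat N N"
    using M G by (auto simp: M'_def G'_def minus_carrier_mat)
  have M'q: "qform M' x = qform M x - \<delta> * (x \<bullet> x)" if "x \<in> carrier_vec N" for x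
    using that M by (simp add: M'_def qform_minus[of _ N] qform_smult_mat[of _ N] qform_one)
  have G'q: "qform G' x = qform G x + \<delta> * (x \<bullet> x)" if "x \<in> carrier_vec N" for x
    using that G by (simp add: G'_def qform_add[of _ N] qform_smult_mat[of _ N] qform_one)
  have \<delta>: "\<delta> > 0" "\<delta>' = 2 * \<delta>" using \<delta>'(1) by (auto simp: \<delta>_def)
  have pos': "qform M' x > 0" if x: "x \<in> carrier_vec N" "x \<noteq> 0\<^sub>v N" "qform G' x \<ge> 0" for x
  proof -
    have "\<delta> * (x \<bullet> x) > 0" using \<delta>(1) scalar_prod_self_pos[OF x(1,2)] by simp
    \<comment> \<open>The gap is 2\<delta>. Its second alternative would make
      \<open>qform G' x\<close> at most -\<delta> times the squared norm, hence negative; the first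
      leaves \<open>qform M' x\<close> at least \<delta> times the squared norm.\<close>
    then show ?thesis using \<delta>'(2)[OF x(1)] x(3) by (auto simp: M'q G'q x(1) \<delta>(2))
  qed
  have "qform G' y > 0" using y \<delta>(1) scalar_prod_self_pos[OF y(1,2)] by (simp add: G'q add_nonneg_pos)
  from S_lemma[OF carr pos' y(1) this] obtain \<alpha> where \<alpha>: "\<alpha> \<ge> 0"
    "\<And>x. x \<in> carrier_vec N \<Longrightarrow> qform M' x \<ge> \<alpha> * qform G' x" by blast
  show ?thesis
  proof (rule that[OF \<alpha>(1) \<delta>(1)])
    fix x :: "real vec" assume x: "x \<in> carrier_vec N"
    have "x \<bullet> x \<ge> 0" using scalar_prod_self_pos[OF x] by (cases "x = 0\<^sub>v N") auto
    then have "\<alpha> * (\<delta> * (x \<bullet> x)) \<ge> 0" using \<alpha>(1) \<delta>(1) by simp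
    then show "qform M x - \<alpha> * qform G x \<ge> \<delta> * (x \<bullet> x)"
      using \<alpha>(2)[OF x] by (simp add: M'q G'q x distrib_left)
  qed
qed

section \<open>Vectorization, Kronecker products and inverses\<close>

text \<open>Column stacking puts row \<open>j\<close> of column \<open>b\<close> at index
  \<open>b * n + j\<close>; this turns sums over stacked indices into double sums.\<close>

lemma sum_div_mod:
  fixes f :: "nat \<Rightarrow> nat \<Rightarrow> 'a::comm_monoid_add"
  shows "(\<Sum>l<p * n. f (l div n) (l mod n)) = (\<Sum>b<p. \<Sum>j<n. f b j)"
proof (cases "n = 0")
  case False
  have "(\<Sum>l = b * n..<b * n + n. f (l div n) (l mod n)) = (\<Sum>j<n. f b j)" for b
    using sum.shift_bounds_nat_ivl[of "\<lambda>l. f (l div n) (l mod n)" 0 "b * n" n] False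
    by (simp add: atLeast0LessThan add.commute)
  then show ?thesis using sum.nat_group[of "\<lambda>l. f (l div n) (l mod n)" n p] by simp
qed simp

lemma vectorize_carrier: "K \<in> carrier_mat n p \<Longrightarrow> vectorize K \<in> carrier_vec (n * p)"
  by (simp add: vectorize_def carrier_vecI)

lemma vectorize_add:
  assumes "K \<in> carrier_mat n p" "L \<in> carrier_mat n p"
  shows "vectorize (K + L) = vectorize K + vectorize L"
proof (rule eq_vecI)
  fix k assume "k < dim_vec (vectorize K + vectorize L)"
  then have k: "k < n * p" using assms by (simp add: vectorize_def)
  then have "k mod n < n" "k div n < p"
    by (cases "n = 0", simp_all add: less_mult_imp_div_less mult.commute)
  then show "vectorize (K + L) $ k = (vectorize K + vectorize L) $ k"
    using assms k by (simp add: vectorize_def)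
qed (use assms in \<open>simp add: vectorize_def\<close>)

lemma vectorize_uminus:
  assumes "K \<in> carrier_mat n p"
  shows "vectorize (- K) = - vectorize K"
proof (rule eq_vecI)
  fix k assume "k < dim_vec (- vectorize K)"
  then have k: "k < n * p" using assms by (simp add: vectorize_def)
  then have "k mod n < n" "k div n < p"
    by (cases "n = 0", simp_all add: less_mult_imp_div_less mult.commute)
  then show "vectorize (- K) $ k = (- vectorize K) $ k"
    using assms k by (simp add: vectorize_def)
qed (use assms in \<open>simp add: vectorize_def\<close>)

text \<open>Both sides are the Frobenius inner product. It is arranged by rows because the weight
  \<open>R\<close> will later act on each row separately.\<close>

lemma scalar_prod_vectorize:
  assumes "K \<in> carrier_mat n p" "L \<in> carrier_mat n p"
  shows "vectorize K \<bullet> vectorize L = (\<Sum>i<n. row K i \<bullet> row L i)"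
proof -
  have "vectorize K \<bullet> vectorize L = (\<Sum>l<p * n. (\<lambda>b j. K $$ (j, b) * L $$ (j, b)) (l div n) (l mod n))"
    using assms by (simp add: scalar_prod_def vectorize_def atLeast0LessThan mult.commute)
  also have "\<dots> = (\<Sum>b<p. \<Sum>i<n. K $$ (i, b) * L $$ (i, b))" by (rule sum_div_mod)
  also have "\<dots> = (\<Sum>i<n. \<Sum>b<p. K $$ (i, b) * L $$ (i, b))" by (rule sum.swap)
  finally show ?thesis using assms
    by (simp add: scalar_prod_def atLeast0LessThan row_def)
qed

lemma kron_carrier:
  "A \<in> carrier_mat q p \<Longrightarrow> B \<in> carrier_mat r s \<Longrightarrow> kron A B \<in> carrier_mat (q * r) (p * s)"
  by (auto simp: kron_def)

lemma transpose_kron_one: "(kron A (1\<^sub>m n))\<^sup>T = kron A\<^sup>T (1\<^sub>m n)"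
proof (rule eq_matI)
  fix i j assume ij: "i < dim_row (kron A\<^sup>T (1\<^sub>m n))" "j < dim_col (kron A\<^sup>T (1\<^sub>m n))"
  then have "i < dim_col A * n" "j < dim_row A * n" by (simp_all add: kron_def)
  then have "n > 0" "i div n < dim_col A" "j div n < dim_row A"
    by (cases "n = 0", simp_all add: less_mult_imp_div_less)
  then show "(kron A (1\<^sub>m n))\<^sup>T $$ (i, j) = kron A\<^sup>T (1\<^sub>m n) $$ (i, j)"
    using ij by (auto simp: kron_def)
qed (simp_all add: kron_def)

lemma kron_one_mult_vectorize:
  assumes A: "A \<in> carrier_mat q p" and K: "K \<in> carrier_mat n p"
  shows "kron A (1\<^sub>m n) *\<^sub>v vectorize K = vectorize (K * A\<^sup>T)"
proof (rule eq_vecI)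
  fix k assume "k < dim_vec (vectorize (K * A\<^sup>T))"
  then have k: "k < q * n" using A K by (simp add: vectorize_def mult.commute)
  then have n: "n > 0" by (cases "n = 0") simp_all
  then have i: "k mod n < n" and a: "k div n < q" using k by (simp_all add: less_mult_imp_div_less)
  have "(kron A (1\<^sub>m n) *\<^sub>v vectorize K) $ k =
    (\<Sum>l<p * n. (\<lambda>b j. A $$ (k div n, b) * (if k mod n = j then 1 else 0) * K $$ (j, b)) (l div n) (l mod n))"
    using A K k n by (auto simp: scalar_prod_def vectorize_def kron_def atLeast0LessThan mult.commute intro!: sum.cong)
  \<comment> \<open>The identity factor keeps only the terms with
    \<open>j = k mod n\<close>.\<close>
  also have "\<dots> = (\<Sum>b<p. A $$ (k div n, b) * K $$ (k mod n, b))"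
    by (subst sum_div_mod) (use i in \<open>simp add: if_distrib if_distribR cong: if_cong\<close>)
  also have "\<dots> = vectorize (K * A\<^sup>T) $ k"
    using A K k n i a by (simp add: vectorize_def scalar_prod_def atLeast0LessThan mult.commute)
  finally show "(kron A (1\<^sub>m n) *\<^sub>v vectorize K) $ k = vectorize (K * A\<^sup>T) $ k" .
qed (use A K in \<open>simp add: vectorize_def kron_def mult.commute\<close>)

lemma scalar_prod_mult_mat_vec:
  fixes A :: "'a::comm_semiring_0 mat"
  assumes "A \<in> carrier_mat r c" "x \<in> carrier_vec c" "y \<in> carrier_vec r"
  shows "(A *\<^sub>v x) \<bullet> y = x \<bullet> (A\<^sup>T *\<^sub>v y)"
proof -
  have "(A *\<^sub>v x) \<bullet> y = (\<Sum>i<r. \<Sum>j<c. A $$ (i, j) * x $ j * y $ i)"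
    using assms by (auto simp: scalar_prod_def atLeast0LessThan sum_distrib_right intro!: sum.cong)
  also have "\<dots> = (\<Sum>j<c. \<Sum>i<r. A $$ (i, j) * x $ j * y $ i)" by (rule sum.swap)
  also have "\<dots> = x \<bullet> (A\<^sup>T *\<^sub>v y)"
    using assms by (auto simp: scalar_prod_def atLeast0LessThan sum_distrib_left ac_simps intro!: sum.cong)
  finally show ?thesis .
qed

text \<open>The trace of \<open>L * R * L\<^sup>T\<close> splits over the rows of \<open>L\<close>:
  symmetry of \<open>R\<close> makes row \<open>i\<close> of \<open>L * R\<close> the image under
  \<open>R\<close> of row \<open>i\<close> of \<open>L\<close>.\<close>

lemma vectorize_quadratic:
  assumes L: "L \<in> carrier_mat n p" and R: "R \<in> sym_mats p"
  shows "vectorize L \<bullet> vectorize (L * R) = (\<Sum>i<n. qform R (row L i))"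
proof -
  have "row (L * R) i = R *\<^sub>v row L i" if "i < n" for i
  proof (rule eq_vecI)
    fix j assume "j < dim_vec (R *\<^sub>v row L i)"
    then show "row (L * R) i $ j = (R *\<^sub>v row L i) $ j"
      using that L R row_transpose[of j R] comm_scalar_prod[of "row L i" p "col R j"]
      by (auto simp: sym_mats_def)
  qed (use L R in \<open>auto simp: sym_mats_def\<close>)
  then show ?thesis
    using scalar_prod_vectorize[OF L, of "L * R"] L R by (simp add: sym_mats_def qform_def)
qed

lemma unvectorize_carrier: "unvectorize r c v \<in> carrier_mat r c"
  by (simp add: unvectorize_def)

text \<open>Every vector of length \<open>n * p\<close>, in particular each unit vector, is the
  stacking of some matrix. Identities between Kronecker-type matrices can thus be checked through
  ordinary matrix products.\<close>

lemma eq_mat_vectorizeI: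
  assumes A: "A \<in> carrier_mat r (n * p)" and B: "B \<in> carrier_mat r (n * p)"
    and eq: "\<And>K. K \<in> carrier_mat n p \<Longrightarrow> A *\<^sub>v vectorize K = B *\<^sub>v vectorize K"
  shows "A = B"
proof (rule eq_matI)
  fix i j assume "i < dim_row B" "j < dim_col B"
  then have ij: "i < r" "j < n * p" using B by auto
  have "A *\<^sub>v unit_vec (n * p) j = B *\<^sub>v unit_vec (n * p) j"
    using eq[OF unvectorize_carrier, of "unit_vec (n * p) j"] by (simp add: vectorize_unvectorize)
  then have "(A *\<^sub>v unit_vec (n * p) j) $ i = (B *\<^sub>v unit_vec (n * p) j) $ i" by simp
  then show "A $$ (i, j) = B $$ (i, j)" using A B ij by simp
qed (use A B in auto)

section \<open>Inverses, pseudoinverses and full row rank\<close>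

lemma pinv_inverse:
  assumes "A \<in> carrier_mat N N" "S \<in> carrier_mat N N" "A * S = 1\<^sub>m N" "S * A = 1\<^sub>m N"
  shows "pinv A = S"
  by (rule pinv_eqI) (use assms in \<open>simp add: is_pinv_def\<close>)

lemma obtain_inverse:
  assumes A: "(A :: real mat) \<in> carrier_mat N N"
    and inj: "\<And>v. v \<in> carrier_vec N \<Longrightarrow> A *\<^sub>v v = 0\<^sub>v N \<Longrightarrow> v = 0\<^sub>v N"
  obtains S where "S \<in> carrier_mat N N" "A * S = 1\<^sub>m N" "S * A = 1\<^sub>m N"
proof -
  have "det A \<noteq> 0" using det_0_iff_vec_prod_zero_field[OF A] inj by blast
  from det_non_zero_imp_unit[OF A this, of "()"] that show ?thesis
    by (auto simp: Units_def ring_mat_def)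
qed

lemma inverse_symmetric:
  assumes A: "A \<in> sym_mats N" and S: "S \<in> carrier_mat N N" "A * S = 1\<^sub>m N" "S * A = 1\<^sub>m N"
  shows "S\<^sup>T = S"
proof -
  have A: "A \<in> carrier_mat N N" "A\<^sup>T = A" using A by (auto simp: sym_mats_def)
  have "S\<^sup>T * A = 1\<^sub>m N" using transpose_mult[OF A(1) S(1)] S A(2) by simp
  then have "S\<^sup>T * A * S = S" using S by simp
  then show ?thesis using S A by (simp add: assoc_mult_mat[of "S\<^sup>T" N N A N S N])
qed

text \<open>At full row rank the columns of \<open>D\<close> span the whole space. A vector killed
  by \<open>D\<^sup>T\<close> is orthogonal to all columns, hence to itself.\<close>

lemma full_row_rank_transpose_inj:
  assumes D: "(D :: real mat) \<in> carrier_mat p T" and rk: "vec_space.rank p D = p"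
    and y: "y \<in> carrier_vec p" and 0: "D\<^sup>T *\<^sub>v y = 0\<^sub>v T"
  shows "y = 0\<^sub>v p"
proof -
  interpret vec_space "TYPE(real)" p .
  have cols: "set (cols D) \<subseteq> carrier_vec p" using D cols_dim by blast
  \<comment> \<open>A maximal independent set of columns has as many elements as the rank, here
    \<open>p\<close>, and is therefore a basis.\<close>
  obtain S where S: "maximal S (\<lambda>T. T \<subseteq> set (cols D) \<and> lin_indpt T)" "finite S"
    using maximal_exists_superset[of "set (cols D)" "\<lambda>T. T \<subseteq> set (cols D) \<and> lin_indpt T" "{}"]
      finite_lin_indpt2[of "{}"] by auto
  have SD: "S \<subseteq> set (cols D)" "lin_indpt S" using S(1) by (auto simp: maximal_def)
  have "card S = p" using rank_card_indpt[OF D S(1)] rk by simp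
  then have "basis S" using SD cols S(2) by (intro dim_li_is_basis) (auto simp: dim_is_n)
  then have "span S = carrier_vec p" by (auto simp: basis_def)
  then have "span (set (cols D)) = carrier_vec p"
    using span_is_monotone[OF SD(1)] span_closed[OF cols] by auto
  moreover have "y \<in> orthogonal_complement (set (cols D))"
  proof -
    have "y \<bullet> col D j = 0" if "j < T" for j
    proof -
      have "(D\<^sup>T *\<^sub>v y) $ j = 0" using 0 that by simp
      then show ?thesis using D y that comm_scalar_prod[of y p "col D j"] by simp
    qed
    then show ?thesis using D y by (auto simp: orthogonal_complement_def cols_def)
  qed
  ultimately have "y \<bullet> y = 0"
    using in_orthogonal_complement_span[OF cols] y by (auto simp: orthogonal_complement_def)
  then show ?thesis using scalar_prod_self_pos[OF y] by force
qed

section \<open>Symmetric matrices and block forms\<close>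

lemma scalar_prod_sym_mat:
  assumes "R \<in> sym_mats N" "x \<in> carrier_vec N" "y \<in> carrier_vec N"
  shows "x \<bullet> (R *\<^sub>v y) = y \<bullet> (R *\<^sub>v x)"
proof -
  have "(R *\<^sub>v y) \<bullet> x = y \<bullet> (R *\<^sub>v x)"
    using scalar_prod_mult_mat_vec[of R N N y x] assms by (simp add: sym_mats_def)
  moreover have "x \<bullet> (R *\<^sub>v y) = (R *\<^sub>v y) \<bullet> x"
    using assms by (intro comm_scalar_prod[of _ N]) (auto simp: sym_mats_def)
  ultimately show ?thesis by simp
qed

text \<open>Because \<open>R * S\<close> is the identity, \<open>R\<close> maps the shift
  \<open>S *\<^sub>v w\<close> back to \<open>w\<close>. The cross terms, equal by symmetry of
  \<open>R\<close>, give twice \<open>w \<bullet> y\<close>, and the last term becomes the form of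
  \<open>S\<close>. Used once for \<open>N\<close> and once for \<open>Q\<close>.\<close>

lemma qform_complete_square:
  assumes R: "R \<in> sym_mats N" and S: "S \<in> carrier_mat N N" "R * S = 1\<^sub>m N"
    and y: "y \<in> carrier_vec N" and w: "w \<in> carrier_vec N"
  shows "qform R (y + S *\<^sub>v w) = qform R y + 2 * (w \<bullet> y) + qform S w"
proof -
  have Rc: "R \<in> carrier_mat N N" using R by (simp add: sym_mats_def)
  have Sw: "S *\<^sub>v w \<in> carrier_vec N" using S w by simp
  have RSw: "R *\<^sub>v (S *\<^sub>v w) = w"
    using assoc_mult_mat_vec[OF Rc S(1) w] S(2) w by simp
  have "qform R (y + S *\<^sub>v w) = qform R y + 2 * (y \<bullet> (R *\<^sub>v (S *\<^sub>v w))) + (S *\<^sub>v w) \<bullet> (R *\<^sub>v (S *\<^sub>v w))"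
    using qform_add_smult[OF Rc y Sw, of 1] scalar_prod_sym_mat[OF R Sw y]
    by (simp add: qform_def)
  then show ?thesis
    unfolding RSw using comm_scalar_prod[OF y w] comm_scalar_prod[OF Sw w] by (simp add: qform_def)
qed

lemma qform_congruence:
  assumes "E \<in> carrier_mat a b" "M \<in> carrier_mat a a" "x \<in> carrier_vec b"
  shows "qform (E\<^sup>T * M * E) x = qform M (E *\<^sub>v x)"
proof -
  have "(E\<^sup>T * M * E) *\<^sub>v x = E\<^sup>T *\<^sub>v (M *\<^sub>v (E *\<^sub>v x))"
    using assms by (simp add: assoc_mult_mat_vec[of _ b a] assoc_mult_mat_vec[of _ b a _ b])
  then show ?thesis
    using assms scalar_prod_mult_mat_vec[of E a b x "M *\<^sub>v (E *\<^sub>v x)"] by (simp add: qform_def)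
qed

lemma sym_mats_congruence:
  assumes "E \<in> carrier_mat a b" "M \<in> sym_mats a"
  shows "E\<^sup>T * M * E \<in> sym_mats b"
proof -
  have M: "M \<in> carrier_mat a a" "M\<^sup>T = M" and E: "E\<^sup>T \<in> carrier_mat b a"
    using assms by (auto simp: sym_mats_def)
  have "(E\<^sup>T * M * E)\<^sup>T = E\<^sup>T * (E\<^sup>T * M)\<^sup>T"
    using E M assms(1) by (intro transpose_mult) auto
  also have "(E\<^sup>T * M)\<^sup>T = M * E" using transpose_mult[OF E M(1)] M(2) by simp
  also have "E\<^sup>T * (M * E) = E\<^sup>T * M * E" using assoc_mult_mat[OF E M(1) assms(1)] by simp
  finally show ?thesis using assms(1) M(1) by (simp add: sym_mats_def)
qed

lemma sym_mats_iff:
  "A \<in> sym_mats N \<longleftrightarrow> A \<in> carrier_mat N N \<and> (\<forall>i<N. \<forall>j<N. A $$ (i, j) = A $$ (j, i))"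
proof -
  have "A\<^sup>T = A \<longleftrightarrow> (\<forall>i<N. \<forall>j<N. A $$ (i, j) = A $$ (j, i))" if A: "A \<in> carrier_mat N N"
  proof
    assume sym: "A\<^sup>T = A"
    have "A\<^sup>T $$ (i, j) = A $$ (j, i)" if "i < N" "j < N" for i j using A that by simp
    then show "\<forall>i<N. \<forall>j<N. A $$ (i, j) = A $$ (j, i)" unfolding sym by blast
  qed (use A in \<open>auto intro!: eq_matI\<close>)
  then show ?thesis by (auto simp: sym_mats_def)
qed

lemma sym_mats_one: "1\<^sub>m N \<in> sym_mats N"
  by (simp add: sym_mats_def)

lemma sym_mats_add: "A \<in> sym_mats N \<Longrightarrow> B \<in> sym_mats N \<Longrightarrow> A + B \<in> sym_mats N"
  by (auto simp: sym_mats_iff)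

lemma sym_mats_minus: "A \<in> sym_mats N \<Longrightarrow> B \<in> sym_mats N \<Longrightarrow> A - B \<in> sym_mats N"
  by (auto simp: sym_mats_iff minus_carrier_mat)

lemma sym_mats_uminus: "A \<in> sym_mats N \<Longrightarrow> - A \<in> sym_mats N"
  by (auto simp: sym_mats_iff)

lemma sym_mats_smult: "A \<in> sym_mats N \<Longrightarrow> k \<cdot>\<^sub>m A \<in> sym_mats N"
  by (auto simp: sym_mats_iff)

lemma qform_four_block:
  assumes A: "A \<in> carrier_mat a a" and B: "B \<in> carrier_mat a b" and D: "D \<in> carrier_mat b b"
    and x: "x \<in> carrier_vec a" and y: "y \<in> carrier_vec b"
  shows "qform (four_block_mat A B B\<^sup>T D) (x @\<^sub>v y) = qform A x + 2 * (x \<bullet> (B *\<^sub>v y)) + qform D y"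
proof -
  have BTx: "B\<^sup>T *\<^sub>v x \<in> carrier_vec b" using B x by simp
  have "y \<bullet> (B\<^sup>T *\<^sub>v x) = x \<bullet> (B *\<^sub>v y)"
    using scalar_prod_mult_mat_vec[OF B y x] comm_scalar_prod[of x a "B *\<^sub>v y"] B x y by simp
  then show ?thesis
    using four_block_mat_mult_vec[OF A B _ D x y, of "B\<^sup>T"]
      scalar_prod_append[OF x y, of "A *\<^sub>v x + B *\<^sub>v y" "B\<^sup>T *\<^sub>v x + D *\<^sub>v y"]
      A B D x y BTx
    by (simp add: qform_def scalar_prod_add_distrib[of _ a] scalar_prod_add_distrib[of _ b])
qed

lemma sym_mats_four_block:
  assumes "A \<in> sym_mats a" "B \<in> carrier_mat a b" "D \<in> sym_mats b"
  shows "four_block_mat A B B\<^sup>T D \<in> sym_mats (a + b)"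
  using assms by (auto simp: sym_mats_def transpose_four_block_mat[of _ a a _ b _ b])

lemma diag_block_mat_pair:
  assumes "A \<in> carrier_mat a a" "B \<in> carrier_mat b b"
  shows "diag_block_mat [A, B] = four_block_mat A (0\<^sub>m a b) (0\<^sub>m a b)\<^sup>T B"
  unfolding diag_block_mat.simps(2)[of A "[B]"] diag_block_mat_singleton Let_def
  using assms by simp

lemma diag_block_mat_Cons: "diag_block_mat (A # Bs) = diag_block_mat [A, diag_block_mat Bs]"
  unfolding diag_block_mat.simps(2)[of A] diag_block_mat_singleton ..

lemma sym_mats_diag_block:
  assumes "A \<in> sym_mats a" "B \<in> sym_mats b"
  shows "diag_block_mat [A, B] \<in> sym_mats (a + b)"
proof -
  have "diag_block_mat [A, B] = four_block_mat A (0\<^sub>m a b) (0\<^sub>m a b)\<^sup>T B"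
    using assms by (intro diag_block_mat_pair) (auto simp: sym_mats_def)
  then show ?thesis using sym_mats_four_block[OF assms(1) zero_carrier_mat assms(2)] by simp
qed

lemma qform_diag_block:
  assumes A: "A \<in> carrier_mat a a" and B: "B \<in> carrier_mat b b"
    and x: "x \<in> carrier_vec a" and y: "y \<in> carrier_vec b"
  shows "qform (diag_block_mat [A, B]) (x @\<^sub>v y) = qform A x + qform B y"
proof -
  have "0\<^sub>m a b *\<^sub>v y = (0\<^sub>v a :: real vec)" using y by (intro eq_vecI) auto
  then show ?thesis
    unfolding diag_block_mat_pair[OF A B]
    using x qform_four_block[OF A zero_carrier_mat B x y] by simp
qed

section \<open>Block extraction and forms with a leading scalar 1\<close>

lemma blk_carrier:
  assumes "M \<in> carrier_mat (a + b) (a + b)"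
  shows "blk11 a M \<in> carrier_mat a a" "blk12 a M \<in> carrier_mat a b"
    "blk21 a M \<in> carrier_mat b a" "blk22 a M \<in> carrier_mat b b"
  using assms by (auto simp: blk11_def blk12_def blk21_def blk22_def split_block_def Let_def)

lemma four_block_blk:
  assumes "M \<in> carrier_mat (a + b) (a + b)"
  shows "M = four_block_mat (blk11 a M) (blk12 a M) (blk21 a M) (blk22 a M)"
  using assms
  by (intro eq_matI) (auto simp: blk11_def blk12_def blk21_def blk22_def split_block_def Let_def)

lemma blk_sym_mats:
  assumes "M \<in> sym_mats (a + b)"
  shows "blk12 a M = (blk21 a M)\<^sup>T" "blk22 a M \<in> sym_mats b"
proof -
  have M: "M \<in> carrier_mat (a + b) (a + b)" "\<And>i j. i < a + b \<Longrightarrow> j < a + b \<Longrightarrow> M $$ (i, j) = M $$ (j, i)"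
    using assms by (auto simp: sym_mats_def) (metis carrier_matD index_transpose_mat(1))
  show "blk12 a M = (blk21 a M)\<^sup>T" "blk22 a M \<in> sym_mats b"
    using M by (auto simp: sym_mats_def blk12_def blk21_def blk22_def split_block_def Let_def intro!: eq_matI)
qed

lemma blk22_four_block:
  assumes "A \<in> carrier_mat a a" "B \<in> carrier_mat a b" "C \<in> carrier_mat b a" "D \<in> carrier_mat b b"
  shows "blk22 a (four_block_mat A B C D) = D"
  using assms by (auto simp: blk22_def split_block_def Let_def intro!: eq_matI)

lemma vCons_append: "vCons a w = vCons a vNil @\<^sub>v w"
  by (rule eq_vecI) (auto simp: less_Suc_eq_0_disj)

lemma mult_vCons_vNil:
  assumes "(B :: real mat) \<in> carrier_mat q 1"
  shows "B *\<^sub>v vCons 1 vNil = col B 0"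
  using assms by (intro eq_vecI) (auto simp: scalar_prod_def)

lemma transpose_mult_column:
  assumes B: "B \<in> carrier_mat q 1" and Y: "Y \<in> carrier_mat q q"
  shows "(B\<^sup>T * Y * B) $$ (0, 0) = qform Y (col B 0)"
proof -
  have "B\<^sup>T * Y * B = B\<^sup>T * (Y * B)" using B Y by (intro assoc_mult_mat) auto
  moreover have "col (Y * B) 0 = Y *\<^sub>v col B 0" using col_mult2[OF Y B] by simp
  ultimately show ?thesis using B Y by (simp add: qform_def del: col_mult2)
qed

text \<open>The leading 1 is treated as the vector \<open>vCons 1 vNil\<close> of a block of size
  one, so that the general block formula applies; symmetry merges the two off-diagonal
  terms.\<close>

lemma qform_vCons:
  assumes M: "M \<in> sym_mats (1 + q)" and w: "w \<in> carrier_vec q"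
  shows "qform M (vCons 1 w) = blk11 1 M $$ (0, 0) + 2 * (col (blk21 1 M) 0 \<bullet> w) + qform (blk22 1 M) w"
proof -
  have Mc: "M \<in> carrier_mat (1 + q) (1 + q)" using M by (simp add: sym_mats_def)
  note B = blk_carrier[OF Mc] and sy = blk_sym_mats[OF M]
  let ?u = "vCons 1 vNil :: real vec"
  have u: "?u \<in> carrier_vec 1" by (rule carrier_vecI) simp
  have t: "(blk12 1 M)\<^sup>T = blk21 1 M" unfolding sy(1) by simp
  have "qform (four_block_mat (blk11 1 M) (blk12 1 M) (blk21 1 M) (blk22 1 M)) (?u @\<^sub>v w) =
    qform (blk11 1 M) ?u + 2 * (?u \<bullet> (blk12 1 M *\<^sub>v w)) + qform (blk22 1 M) w"
    using qform_four_block[OF B(1,2,4) u w] unfolding t .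
  then have "qform M (vCons 1 w) =
    qform (blk11 1 M) ?u + 2 * (?u \<bullet> (blk12 1 M *\<^sub>v w)) + qform (blk22 1 M) w"
    unfolding vCons_append[of 1 w, symmetric] four_block_blk[OF Mc, symmetric] .
  moreover have "qform (blk11 1 M) ?u = blk11 1 M $$ (0, 0)"
    using mult_vCons_vNil[OF B(1)] B(1) by (simp add: qform_def scalar_prod_def)
  moreover have "?u \<bullet> (blk12 1 M *\<^sub>v w) = col (blk21 1 M) 0 \<bullet> w"
    unfolding sy(1) using scalar_prod_mult_mat_vec[OF B(3) u w] mult_vCons_vNil[OF B(3)] by simp
  ultimately show ?thesis by simp
qed

section \<open>Image of a weighted Frobenius ball in one direction\<close>

text \<open>A Cauchy-Schwarz estimate: the norm of \<open>L\<^sup>T *\<^sub>v v\<close> is at most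
  the norm of \<open>v\<close> times the Frobenius norm of \<open>L\<close>, all squared and
  weighted by \<open>- R\<close>, which reverses the inequality.\<close>

lemma qform_transpose_mult_ge:
  assumes R: "R \<in> sym_mats p" and neg: "\<And>y. y \<in> carrier_vec p \<Longrightarrow> qform R y \<le> 0"
    and L: "L \<in> carrier_mat n p" and v: "v \<in> carrier_vec n"
  shows "(v \<bullet> v) * (\<Sum>i<n. qform R (row L i)) \<le> qform R (L\<^sup>T *\<^sub>v v)"
proof (cases "v = 0\<^sub>v n")
  case True
  have "L\<^sup>T *\<^sub>v v = 0\<^sub>v p" using L True by (intro eq_vecI) auto
  then show ?thesis using True R qform_zero[of R p] by (simp add: sym_mats_def)
next
  case False
  have Rc: "R \<in> carrier_mat p p" using R by (simp add: sym_mats_def)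
  define r where "r = v \<bullet> v"
  have r: "r > 0" using scalar_prod_self_pos[OF v False] by (simp add: r_def)
  have rs: "r = (\<Sum>i<n. (v $ i)\<^sup>2)"
    using v by (simp add: r_def scalar_prod_def atLeast0LessThan power2_eq_square)
  define z where "z = L\<^sup>T *\<^sub>v v"
  have z: "z \<in> carrier_vec p" using L v by (simp add: z_def)
  have Rz: "R *\<^sub>v z \<in> carrier_vec p" using Rc z by simp
  have rowL: "row L i \<in> carrier_vec p" for i by (rule carrier_vecI) (use L in simp)
  have zz: "(\<Sum>i<n. v $ i * (row L i \<bullet> (R *\<^sub>v z))) = qform R z"
  proof -
    have "(\<Sum>i<n. v $ i * (row L i \<bullet> (R *\<^sub>v z))) = v \<bullet> (L *\<^sub>v (R *\<^sub>v z))"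
      using L by (simp add: scalar_prod_def[of v] atLeast0LessThan)
    also have "\<dots> = z \<bullet> (R *\<^sub>v z)"
      using scalar_prod_mult_mat_vec[of "L\<^sup>T" p n v "R *\<^sub>v z"] L v Rz by (simp add: z_def)
    finally show ?thesis by (simp add: qform_def)
  qed
  \<comment> \<open>The shifted rows are those of \<open>L - v z\<^sup>T / r\<close>, the part of \<open>L\<close> that \<open>v\<close> annihilates.\<close>
  have "0 \<ge> (\<Sum>i<n. qform R (row L i + (- v $ i / r) \<cdot>\<^sub>v z))"
    using rowL z by (intro sum_nonpos neg) auto
  also have "(\<Sum>i<n. qform R (row L i + (- v $ i / r) \<cdot>\<^sub>v z)) =
    (\<Sum>i<n. qform R (row L i) - 2 / r * (v $ i * (row L i \<bullet> (R *\<^sub>v z))) + (v $ i)\<^sup>2 * (qform R z / r\<^sup>2))"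
    using scalar_prod_sym_mat[OF R z rowL]
    by (intro sum.cong refl) (simp add: qform_add_smult[OF Rc rowL z] field_simps power2_eq_square)
  also have "\<dots> = (\<Sum>i<n. qform R (row L i)) - 2 / r * qform R z + r * (qform R z / r\<^sup>2)"
    by (simp only: sum.distrib sum_subtractf zz rs flip: sum_distrib_left sum_distrib_right)
  also have "\<dots> = (\<Sum>i<n. qform R (row L i)) - qform R z / r"
    using r by (simp add: field_simps power2_eq_square)
  finally show ?thesis using r by (simp add: field_simps r_def[symmetric] z_def[symmetric])
qed

text \<open>The equality case of the preceding estimate: the outer product of \<open>v\<close> and
  \<open>z\<close>, divided by the squared norm of \<open>v\<close>, maps \<open>v\<close> to
  \<open>z\<close> under transposition, and all its rows are multiples of \<open>z\<close>.\<close>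

lemma qform_rank_one:
  assumes R: "R \<in> carrier_mat p p" and v: "v \<in> carrier_vec n" "v \<noteq> 0\<^sub>v n" and z: "z \<in> carrier_vec p"
  obtains L where "L \<in> carrier_mat n p" "L\<^sup>T *\<^sub>v v = z"
    "(v \<bullet> v) * (\<Sum>i<n. qform R (row L i)) = qform R z"
proof
  define r where "r = v \<bullet> v"
  have r: "r > 0" using scalar_prod_self_pos[OF v] by (simp add: r_def)
  have rs: "r = (\<Sum>i<n. (v $ i)\<^sup>2)"
    using v by (simp add: r_def scalar_prod_def atLeast0LessThan power2_eq_square)
  let ?L = "mat n p (\<lambda>(i, j). v $ i * z $ j / r)"
  show "?L \<in> carrier_mat n p" by simp
  show "?L\<^sup>T *\<^sub>v v = z"
  proof (rule eq_vecI)
    fix j assume "j < dim_vec z"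
    then have "(?L\<^sup>T *\<^sub>v v) $ j = (\<Sum>i<n. (v $ i)\<^sup>2 * (z $ j / r))"
      using v z by (auto simp: scalar_prod_def atLeast0LessThan power2_eq_square intro!: sum.cong)
    also have "\<dots> = z $ j"
      unfolding sum_distrib_right[symmetric] rs[symmetric] using r by simp
    finally show "(?L\<^sup>T *\<^sub>v v) $ j = z $ j" .
  qed (use z in auto)
  have "row ?L i = (v $ i / r) \<cdot>\<^sub>v z" if "i < n" for i
    using that z by (intro eq_vecI) auto
  then have "(\<Sum>i<n. qform R (row ?L i)) = (\<Sum>i<n. (v $ i)\<^sup>2 * (qform R z / r\<^sup>2))"
    by (intro sum.cong refl) (simp add: qform_smult[OF R z] power_divide)
  also have "\<dots> = r * (qform R z / r\<^sup>2)"
    unfolding sum_distrib_right[symmetric] rs[symmetric] ..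
  finally show "(v \<bullet> v) * (\<Sum>i<n. qform R (row ?L i)) = qform R z"
    using r by (simp add: r_def[symmetric] power2_eq_square)
qed

section \<open>The set of compatible systems\<close>

locale noisy_data =
  fixes n m T :: nat and U X \<Phi> \<phi> :: "real mat"
  assumes U: "U \<in> carrier_mat m T" and X: "X \<in> carrier_mat n (T + 1)"
    and \<Phi>: "\<Phi> \<in> sym_mats (1 + n * T)" and \<phi>: "\<phi> \<in> sym_mats T"
    and \<Phi>22: "blk22 1 \<Phi> = kron \<phi> (1\<^sub>m n)" and pd_\<phi>: "pd T (- \<phi>)"
    and rank_D: "vec_space.rank (n + m) (data_stack U X) = n + m"
begin

abbreviation "D \<equiv> data_stack U X"
abbreviation "R \<equiv> Q22 U X \<phi>"
abbreviation "N \<equiv> N_mat n m T U X \<Phi>"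
abbreviation "Q12' \<equiv> Q12 n m T U X \<Phi>"
abbreviation "s \<equiv> schur_compl 1 N $$ (0, 0)"

text \<open>The matrix \<open>- Z\<close> is the centre of the weighted ball of compatible
  \<open>K = [A B]\<close>.\<close>

definition "Z = Q12' * pinv R"

lemma X_minus_carrier: "X_minus X \<in> carrier_mat n T"
  and X_plus_carrier: "X_plus X \<in> carrier_mat n T"
  using X by (auto simp: X_minus_def X_plus_def)

lemma D_carrier: "D \<in> carrier_mat (n + m) T"
  unfolding data_stack_def using X_minus_carrier U by auto

lemma R_sym: "R \<in> sym_mats (n + m)"
  using sym_mats_congruence[of "D\<^sup>T" T "n + m" \<phi>] D_carrier \<phi> by (simp add: Q22_def)

lemma R_carrier: "R \<in> carrier_mat (n + m) (n + m)"
  using R_sym by (simp add: sym_mats_def)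

text \<open>The form of \<open>R\<close> at \<open>y\<close> is the form of the negative definite
  \<phi> at \<open>D\<^sup>T *\<^sub>v y\<close>, and full row rank keeps that vector
  nonzero.\<close>

lemma qform_R_neg:
  assumes y: "y \<in> carrier_vec (n + m)" "y \<noteq> 0\<^sub>v (n + m)"
  shows "qform R y < 0"
proof -
  have \<phi>c: "\<phi> \<in> carrier_mat T T" using \<phi> by (simp add: sym_mats_def)
  have Dy: "D\<^sup>T *\<^sub>v y \<in> carrier_vec T" using D_carrier y by simp
  have "D\<^sup>T *\<^sub>v y \<noteq> 0\<^sub>v T" using full_row_rank_transpose_inj[OF D_carrier rank_D y(1)] y(2) by blast
  then have "qform (- \<phi>) (D\<^sup>T *\<^sub>v y) > 0" using pd_\<phi> Dy by (simp add: pd_def qform_def)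
  then show ?thesis
    using qform_congruence[of "D\<^sup>T" T "n + m" \<phi> y] D_carrier \<phi>c y qform_uminus[OF \<phi>c Dy]
    by (simp add: Q22_def)
qed

lemma qform_R_le: "y \<in> carrier_vec (n + m) \<Longrightarrow> qform R y \<le> 0"
  using qform_R_neg[of y] qform_zero[OF R_carrier] by (cases "y = 0\<^sub>v (n + m)") auto

text \<open>Negative definiteness makes \<open>R\<close> injective, hence invertible, so its
  pseudoinverse is the true inverse and inherits symmetry.\<close>

lemma pinv_R_carrier: "pinv R \<in> carrier_mat (n + m) (n + m)"
  and R_pinv_R: "R * pinv R = 1\<^sub>m (n + m)"
  and pinv_R_R: "pinv R * R = 1\<^sub>m (n + m)"
  and pinv_R_sym: "(pinv R)\<^sup>T = pinv R"
proof -
  have "v = 0\<^sub>v (n + m)" if "v \<in> carrier_vec (n + m)" "R *\<^sub>v v = 0\<^sub>v (n + m)" for v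
    using qform_R_neg[of v] that by (force simp: qform_def)
  from obtain_inverse[OF R_carrier this] obtain S
    where S: "S \<in> carrier_mat (n + m) (n + m)" "R * S = 1\<^sub>m (n + m)" "S * R = 1\<^sub>m (n + m)" .
  show "pinv R \<in> carrier_mat (n + m) (n + m)" "R * pinv R = 1\<^sub>m (n + m)"
    "pinv R * R = 1\<^sub>m (n + m)" "(pinv R)\<^sup>T = pinv R"
    using S inverse_symmetric[OF R_sym S] by (simp_all add: pinv_inverse[OF R_carrier S])
qed

lemma Q12_carrier: "Q12' \<in> carrier_mat n (n + m)"
  by (simp add: Q12_def unvectorize_def)

lemma Z_carrier: "Z \<in> carrier_mat n (n + m)"
  using Q12_carrier pinv_R_carrier by (simp add: Z_def)

section \<open>The form of \<open>N\<close> as a function of the system\<close>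

abbreviation "c \<equiv> mat_of_cols (n * T) [vectorize (X_plus X)]"
abbreviation "G \<equiv> kron D\<^sup>T (1\<^sub>m n)"
abbreviation "E \<equiv> E_mat n m T U X"

lemma c_carrier: "c \<in> carrier_mat (n * T) 1"
  by (simp add: mat_of_cols_def)

lemma G_carrier: "G \<in> carrier_mat (n * T) (n * (n + m))"
  using kron_carrier[of "D\<^sup>T" T "n + m" "1\<^sub>m n" n n] D_carrier by (simp add: mult.commute)

lemma E_carrier: "E \<in> carrier_mat (1 + n * T) (1 + n * (n + m))"
  unfolding E_mat_def using c_carrier G_carrier by (intro four_block_carrier_mat) auto

lemma N_sym: "N \<in> sym_mats (1 + n * (n + m))"
  unfolding N_mat_def by (rule sym_mats_congruence[OF E_carrier \<Phi>])

lemma N_carrier: "N \<in> carrier_mat (1 + n * (n + m)) (1 + n * (n + m))"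
  using N_sym by (simp add: sym_mats_def)

lemma G_mult_vectorize:
  "K \<in> carrier_mat n (n + m) \<Longrightarrow> G *\<^sub>v vectorize K = vectorize (K * D)"
  using kron_one_mult_vectorize[of "D\<^sup>T" T "n + m" K n] D_carrier by simp

text \<open>\<open>E\<close> turns a system into the noise it implies, since
  \<open>W = X_plus X - K * D\<close> is the only matrix with \<open>X_plus X = K * D + W\<close>.
  Hence the form of \<open>N\<close> at \<open>K\<close> is the form of \<Phi> at that
  noise.\<close>

lemma E_mult_vCons:
  assumes K: "K \<in> carrier_mat n (n + m)"
  shows "E *\<^sub>v vCons 1 (vectorize K) = vCons 1 (vectorize (X_plus X - K * D))"
proof -
  have u: "vCons 1 vNil \<in> carrier_vec 1" by (rule carrier_vecI) simp
  have vK: "vectorize K \<in> carrier_vec (n * (n + m))" by (rule vectorize_carrier[OF K])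
  have KD: "K * D \<in> carrier_mat n T" using K D_carrier by simp
  have mG: "- G \<in> carrier_mat (n * T) (n * (n + m))" using G_carrier by simp
  have Xv: "vectorize (X_plus X) \<in> carrier_vec (n * T)" by (rule vectorize_carrier[OF X_plus_carrier])
  have "E *\<^sub>v (vCons 1 vNil @\<^sub>v vectorize K) =
    (1\<^sub>m 1 *\<^sub>v vCons 1 vNil + 0\<^sub>m 1 (n * (n + m)) *\<^sub>v vectorize K) @\<^sub>v
    (c *\<^sub>v vCons 1 vNil + (- G) *\<^sub>v vectorize K)"
    unfolding E_mat_def by (rule four_block_mat_mult_vec[OF one_carrier_mat zero_carrier_mat c_carrier mG u vK])
  also have "1\<^sub>m 1 *\<^sub>v vCons 1 vNil + 0\<^sub>m 1 (n * (n + m)) *\<^sub>v vectorize K = vCons 1 vNil"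
  proof -
    have "0\<^sub>m 1 (n * (n + m)) *\<^sub>v vectorize K = 0\<^sub>v 1" using vK by (intro eq_vecI) auto
    then show ?thesis using u one_mult_mat_vec[OF u] by simp
  qed
  also have "c *\<^sub>v vCons 1 vNil = vectorize (X_plus X)"
    using mult_vCons_vNil[OF c_carrier] Xv by simp
  also have "(- G) *\<^sub>v vectorize K = - vectorize (K * D)"
    using G_carrier vK G_mult_vectorize[OF K] by (simp add: uminus_mult_mat_vec)
  also have "vectorize (X_plus X) + - vectorize (K * D) = vectorize (X_plus X - K * D)"
  proof -
    have "X_plus X - K * D = X_plus X + - (K * D)"
      using X_plus_carrier KD by (intro eq_matI) auto
    then show ?thesis
      using vectorize_add[OF X_plus_carrier, of "- (K * D)"] vectorize_uminus[OF KD] KD by simp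
  qed
  finally show ?thesis by (simp flip: vCons_append[of 1])
qed

text \<open>The upper right block of \<open>E\<close> is zero, so only the lower right block
  \<open>- G\<close> meets the corresponding block of \<Phi>; the two signs cancel.\<close>

lemma blk22_N: "blk22 1 N = G\<^sup>T * blk22 1 \<Phi> * G"
proof -
  have \<Phi>c: "\<Phi> \<in> carrier_mat (1 + n * T) (1 + n * T)" using \<Phi> by (simp add: sym_mats_def)
  note B = blk_carrier[OF \<Phi>c]
  let ?q = "n * (n + m)"
  let ?H = "(- G)\<^sup>T"
  have mG: "- G \<in> carrier_mat (n * T) ?q" and H: "?H \<in> carrier_mat ?q (n * T)"
    and cT: "c\<^sup>T \<in> carrier_mat 1 (n * T)"
    using G_carrier c_carrier by auto
  have z: "(0\<^sub>m 1 ?q :: real mat)\<^sup>T = 0\<^sub>m ?q 1" by (intro eq_matI) auto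
  have ET: "E\<^sup>T = four_block_mat (1\<^sub>m 1) c\<^sup>T (0\<^sub>m ?q 1) ?H"
    unfolding E_mat_def
    by (subst transpose_four_block_mat[OF one_carrier_mat zero_carrier_mat c_carrier mG]) (simp only: z transpose_one)
  \<comment> \<open>The blocks of \<open>E\<^sup>T * \<Phi>\<close>. Only the lower ones,
    \<open>?C\<close> and \<open>?D\<close>, enter the lower right block of
    \<open>N\<close>.\<close>
  let ?A = "1\<^sub>m 1 * blk11 1 \<Phi> + c\<^sup>T * blk21 1 \<Phi>" and ?B = "1\<^sub>m 1 * blk12 1 \<Phi> + c\<^sup>T * blk22 1 \<Phi>"
    and ?C = "0\<^sub>m ?q 1 * blk11 1 \<Phi> + ?H * blk21 1 \<Phi>" and ?D = "0\<^sub>m ?q 1 * blk12 1 \<Phi> + ?H * blk22 1 \<Phi>"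
  have "E\<^sup>T * \<Phi> = E\<^sup>T * four_block_mat (blk11 1 \<Phi>) (blk12 1 \<Phi>) (blk21 1 \<Phi>) (blk22 1 \<Phi>)"
    using four_block_blk[OF \<Phi>c] by (rule arg_cong)
  also have "\<dots> = four_block_mat ?A ?B ?C ?D"
    unfolding ET by (rule mult_four_block_mat[OF one_carrier_mat cT zero_carrier_mat H B])
  finally have N: "N = four_block_mat ?A ?B ?C ?D * four_block_mat (1\<^sub>m 1) (0\<^sub>m 1 ?q) c (- G)"
    by (simp add: N_mat_def E_mat_def)
  have carr: "?A \<in> carrier_mat 1 1" "?B \<in> carrier_mat 1 (n * T)"
    "?C \<in> carrier_mat ?q 1" "?D \<in> carrier_mat ?q (n * T)"
    using B cT H by (auto intro!: add_carrier_mat mult_carrier_mat)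
  have "blk22 1 N = ?C * 0\<^sub>m 1 ?q + ?D * (- G)"
    unfolding N mult_four_block_mat[OF carr one_carrier_mat zero_carrier_mat c_carrier mG]
    by (rule blk22_four_block[OF
          add_carrier_mat[OF mult_carrier_mat[OF carr(2) c_carrier]]
          add_carrier_mat[OF mult_carrier_mat[OF carr(2) mG]]
          add_carrier_mat[OF mult_carrier_mat[OF carr(4) c_carrier]]
          add_carrier_mat[OF mult_carrier_mat[OF carr(4) mG]]])
  moreover have "?C * 0\<^sub>m 1 ?q = 0\<^sub>m ?q ?q" by (rule right_mult_zero_mat[OF carr(3)])
  moreover have "?D = ?H * blk22 1 \<Phi>"
  proof -
    have "0\<^sub>m ?q 1 * blk12 1 \<Phi> = 0\<^sub>m ?q (n * T)" using B by simp
    moreover have "?H * blk22 1 \<Phi> \<in> carrier_mat ?q (n * T)" using H B by simp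
    ultimately show ?thesis by simp
  qed
  moreover have "?H = - G\<^sup>T" using G_carrier by (intro eq_matI) auto
  moreover have "- G\<^sup>T * blk22 1 \<Phi> * (- G) = G\<^sup>T * blk22 1 \<Phi> * G"
    using G_carrier B by simp
  moreover have "G\<^sup>T * blk22 1 \<Phi> * G \<in> carrier_mat ?q ?q" using G_carrier B by simp
  ultimately show ?thesis by simp
qed

text \<open>In effect the lower right block of \<open>N\<close> is the Kronecker product of
  \<open>R\<close> with the identity. Each of the three Kronecker factors acts on a stacked matrix
  as a multiplication from the right, by \<open>D\<close>, then \<phi>, then
  \<open>D\<^sup>T\<close>, and these combine to \<open>R\<close>.\<close>

lemma blk22_N_mult_vectorize:
  assumes K: "K \<in> carrier_mat n (n + m)"
  shows "blk22 1 N *\<^sub>v vectorize K = vectorize (K * R)"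
proof -
  have \<phi>c: "\<phi> \<in> carrier_mat T T" "\<phi>\<^sup>T = \<phi>" using \<phi> by (auto simp: sym_mats_def)
  have KD: "K * D \<in> carrier_mat n T" using K D_carrier by simp
  have vK: "vectorize K \<in> carrier_vec (n * (n + m))" by (rule vectorize_carrier[OF K])
  have k\<phi>: "kron \<phi> (1\<^sub>m n) \<in> carrier_mat (n * T) (n * T)"
    using kron_carrier[of \<phi> T T "1\<^sub>m n" n n] \<phi>c by (simp add: mult.commute)
  have GT: "G\<^sup>T \<in> carrier_mat (n * (n + m)) (n * T)" using G_carrier by simp
  have "blk22 1 N *\<^sub>v vectorize K = G\<^sup>T *\<^sub>v (kron \<phi> (1\<^sub>m n) *\<^sub>v (G *\<^sub>v vectorize K))"
    unfolding blk22_N \<Phi>22 using GT k\<phi> G_carrier vK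
    by (simp add: assoc_mult_mat_vec[of _ "n * (n + m)" "n * T"] assoc_mult_mat_vec[of _ "n * (n + m)" "n * T" _ "n * (n + m)"])
  also have "\<dots> = kron D (1\<^sub>m n) *\<^sub>v vectorize (K * D * \<phi>)"
    using kron_one_mult_vectorize[OF \<phi>c(1) KD] \<phi>c(2)
    by (simp add: G_mult_vectorize[OF K] transpose_kron_one)
  also have "\<dots> = vectorize (K * D * \<phi> * D\<^sup>T)"
    using kron_one_mult_vectorize[OF D_carrier, of "K * D * \<phi>" n] KD \<phi>c by simp
  also have "K * D * \<phi> * D\<^sup>T = K * R"
  proof -
    have "K * D * \<phi> * D\<^sup>T = K * (D * \<phi>) * D\<^sup>T"
      using assoc_mult_mat[OF K D_carrier \<phi>c(1)] by simp
    also have "\<dots> = K * (D * \<phi> * D\<^sup>T)"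
      using K D_carrier \<phi>c by (intro assoc_mult_mat[of _ n "n + m" _ T _ "n + m"]) auto
    finally show ?thesis by (simp add: Q22_def)
  qed
  finally show ?thesis .
qed

lemma kron_pinv_R_carrier:
  "kron (pinv R) (1\<^sub>m n) \<in> carrier_mat (n * (n + m)) (n * (n + m))"
  using kron_carrier[OF pinv_R_carrier, of "1\<^sub>m n" n n] by (simp add: mult.commute)

lemma kron_pinv_R_mult_vectorize:
  "K \<in> carrier_mat n (n + m) \<Longrightarrow> kron (pinv R) (1\<^sub>m n) *\<^sub>v vectorize K = vectorize (K * pinv R)"
  using kron_one_mult_vectorize[OF pinv_R_carrier] pinv_R_sym by simp

text \<open>On stacked matrices the two factors are right multiplications by \<open>R\<close> and by
  its inverse, which undo each other.\<close>

lemma blk22_N_inverse: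
  "blk22 1 N * kron (pinv R) (1\<^sub>m n) = 1\<^sub>m (n * (n + m))" (is ?right)
  "kron (pinv R) (1\<^sub>m n) * blk22 1 N = 1\<^sub>m (n * (n + m))" (is ?left)
proof -
  note Y = kron_pinv_R_carrier and N22 = blk_carrier(4)[OF N_carrier]
  show ?right
  proof (rule eq_mat_vectorizeI)
    fix K :: "real mat" assume K: "K \<in> carrier_mat n (n + m)"
    have "K * pinv R * R = K"
      using K pinv_R_R by (simp add: assoc_mult_mat[OF K pinv_R_carrier R_carrier])
    then show "(blk22 1 N * kron (pinv R) (1\<^sub>m n)) *\<^sub>v vectorize K = 1\<^sub>m (n * (n + m)) *\<^sub>v vectorize K"
      using K vectorize_carrier[OF K] pinv_R_carrier
      by (simp only: assoc_mult_mat_vec[OF N22 Y vectorize_carrier[OF K]] kron_pinv_R_mult_vectorize)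
        (subst blk22_N_mult_vectorize, auto)
  qed (use Y N22 in auto)
  show ?left
  proof (rule eq_mat_vectorizeI)
    fix K :: "real mat" assume K: "K \<in> carrier_mat n (n + m)"
    have "K * R * pinv R = K"
      using K R_pinv_R by (simp add: assoc_mult_mat[OF K R_carrier pinv_R_carrier])
    then show "(kron (pinv R) (1\<^sub>m n) * blk22 1 N) *\<^sub>v vectorize K = 1\<^sub>m (n * (n + m)) *\<^sub>v vectorize K"
      using K vectorize_carrier[OF K] R_carrier
      by (simp only: assoc_mult_mat_vec[OF Y N22 vectorize_carrier[OF K]] blk22_N_mult_vectorize)
        (subst kron_pinv_R_mult_vectorize, auto)
  qed (use Y N22 in auto)
qed

lemma vectorize_Q12': "vectorize Q12' = col (blk21 1 N) 0"
  by (rule vectorize_Q12[OF U X])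

text \<open>With the inverse of the lower right block explicit, the correction in the Schur
  complement is its form at the column block of \<open>N\<close>, which is the stacking of
  \<open>Q12'\<close>.\<close>

lemma schur_N: "s = blk11 1 N $$ (0, 0) - qform (kron (pinv R) (1\<^sub>m n)) (vectorize Q12')"
proof -
  note Y = kron_pinv_R_carrier and B = blk_carrier[OF N_carrier]
  have "pinv (blk22 1 N) = kron (pinv R) (1\<^sub>m n)"
    by (rule pinv_inverse[OF B(4) Y blk22_N_inverse])
  then have "schur_compl 1 N = blk11 1 N - (blk21 1 N)\<^sup>T * kron (pinv R) (1\<^sub>m n) * blk21 1 N"
    unfolding schur_compl_def blk_sym_mats(1)[OF N_sym] by simp
  then show ?thesis
    using transpose_mult_column[OF B(3) Y] B Y by (simp add: vectorize_Q12')
qed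

text \<open>Completing the square shifts the stacked \<open>K\<close> by the inverse of the lower
  right block applied to the stacked \<open>Q12'\<close>, that is, by the stacked \<open>Z\<close>.
  The constant left over is the Schur complement \<open>s\<close>.\<close>

lemma qform_N:
  assumes K: "K \<in> carrier_mat n (n + m)"
  shows "qform N (vCons 1 (vectorize K)) = s + (\<Sum>i<n. qform R (row (K + Z) i))"
proof -
  let ?Y = "kron (pinv R) (1\<^sub>m n)"
  note vK = vectorize_carrier[OF K] and vQ = vectorize_carrier[OF Q12_carrier]
  have L: "K + Z \<in> carrier_mat n (n + m)" using K Z_carrier by simp
  have "vectorize K + ?Y *\<^sub>v vectorize Q12' = vectorize (K + Z)"
    using vectorize_add[OF K Z_carrier] kron_pinv_R_mult_vectorize[OF Q12_carrier] by (simp add: Z_def)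
  then have "qform (blk22 1 N) (vectorize (K + Z)) =
    qform (blk22 1 N) (vectorize K) + 2 * (vectorize Q12' \<bullet> vectorize K) + qform ?Y (vectorize Q12')"
    using qform_complete_square[OF blk_sym_mats(2)[OF N_sym] kron_pinv_R_carrier blk22_N_inverse(1) vK vQ] by simp
  moreover have "qform (blk22 1 N) (vectorize (K + Z)) = (\<Sum>i<n. qform R (row (K + Z) i))"
    using vectorize_quadratic[OF L R_sym] blk22_N_mult_vectorize[OF L] by (simp add: qform_def)
  ultimately show ?thesis
    using qform_vCons[OF N_sym vK] schur_N vectorize_Q12' by simp
qed

lemma compatible_iff:
  assumes K: "K \<in> carrier_mat n (n + m)"
  shows "(\<exists>W \<in> W_F n T \<Phi>. X_plus X = K * D + W) \<longleftrightarrow> s + (\<Sum>i<n. qform R (row (K + Z) i)) \<ge> 0"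
proof -
  have \<Phi>c: "\<Phi> \<in> carrier_mat (1 + n * T) (1 + n * T)" using \<Phi> by (simp add: sym_mats_def)
  have KD: "K * D \<in> carrier_mat n T" using K D_carrier by simp
  have x: "vCons 1 (vectorize K) \<in> carrier_vec (1 + n * (n + m))"
    using vectorize_carrier[OF K] by (intro carrier_vecI) auto
  have "(\<exists>W \<in> W_F n T \<Phi>. X_plus X = K * D + W) \<longleftrightarrow> X_plus X - K * D \<in> W_F n T \<Phi>"
  proof
    assume "\<exists>W \<in> W_F n T \<Phi>. X_plus X = K * D + W"
    then obtain W where W: "W \<in> W_F n T \<Phi>" "X_plus X = K * D + W" by blast
    then have "W \<in> carrier_mat n T" by (simp add: W_F_def)
    then have "X_plus X - K * D = W" using W(2) K D_carrier by (intro eq_matI) auto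
    then show "X_plus X - K * D \<in> W_F n T \<Phi>" using W(1) by simp
  next
    assume "X_plus X - K * D \<in> W_F n T \<Phi>"
    moreover have "X_plus X = K * D + (X_plus X - K * D)"
      using X_plus_carrier K D_carrier by (intro eq_matI) auto
    ultimately show "\<exists>W \<in> W_F n T \<Phi>. X_plus X = K * D + W" by blast
  qed
  also have "\<dots> \<longleftrightarrow> qform \<Phi> (vCons 1 (vectorize (X_plus X - K * D))) \<ge> 0"
    using X_plus_carrier KD by (simp add: W_F_def qform_def minus_carrier_mat)
  also have "qform \<Phi> (vCons 1 (vectorize (X_plus X - K * D))) = qform N (vCons 1 (vectorize K))"
    using qform_congruence[OF E_carrier \<Phi>c x] E_mult_vCons[OF K] by (simp add: N_mat_def)
  finally show ?thesis by (simp add: qform_N[OF K])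
qed

section \<open>The form of \<open>Q\<close>\<close>

abbreviation "Q \<equiv> Q_mat n m T U X \<Phi> \<phi>"

lemma Q_eq: "Q = four_block_mat (s \<cdot>\<^sub>m 1\<^sub>m n + Q12' * pinv R * Q12'\<^sup>T) Q12' Q12'\<^sup>T R"
  by (simp add: Q_mat_def Let_def)

lemma Q11_sym: "Q12' * pinv R * Q12'\<^sup>T \<in> sym_mats n"
  using sym_mats_congruence[of "Q12'\<^sup>T" "n + m" n "pinv R"] Q12_carrier pinv_R_carrier pinv_R_sym
  by (simp add: sym_mats_def)

lemma Q_sym: "Q \<in> sym_mats (n + (n + m))"
proof -
  have "s \<cdot>\<^sub>m 1\<^sub>m n + Q12' * pinv R * Q12'\<^sup>T \<in> sym_mats n"
    by (intro sym_mats_add sym_mats_smult sym_mats_one Q11_sym)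
  then show ?thesis unfolding Q_eq by (rule sym_mats_four_block[OF _ Q12_carrier R_sym])
qed

text \<open>The summand \<open>Q12' * pinv R * Q12'\<^sup>T\<close> in the upper left block is
  exactly what completes the square in \<open>y\<close>, leaving \<open>s\<close> times the
  identity.\<close>

lemma qform_Q:
  assumes v: "v \<in> carrier_vec n" and y: "y \<in> carrier_vec (n + m)"
  shows "qform Q (v @\<^sub>v y) = s * (v \<bullet> v) + qform R (y + Z\<^sup>T *\<^sub>v v)"
proof -
  let ?w = "Q12'\<^sup>T *\<^sub>v v"
  have Q12T: "Q12'\<^sup>T \<in> carrier_mat (n + m) n" using Q12_carrier by simp
  have w: "?w \<in> carrier_vec (n + m)" using Q12T v by simp
  have A: "Q12' * pinv R * Q12'\<^sup>T \<in> carrier_mat n n" using Q11_sym by (simp add: sym_mats_def)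
  have "Z\<^sup>T = pinv R * Q12'\<^sup>T"
    using transpose_mult[OF Q12_carrier pinv_R_carrier] pinv_R_sym by (simp add: Z_def)
  then have Zv: "Z\<^sup>T *\<^sub>v v = pinv R *\<^sub>v ?w"
    using assoc_mult_mat_vec[OF pinv_R_carrier Q12T v] by simp
  have "qform (s \<cdot>\<^sub>m 1\<^sub>m n + Q12' * pinv R * Q12'\<^sup>T) v = s * (v \<bullet> v) + qform (pinv R) ?w"
    using qform_add[OF _ A v, of "s \<cdot>\<^sub>m 1\<^sub>m n"] qform_smult_mat[OF one_carrier_mat v] qform_one[OF v]
      qform_congruence[OF Q12T pinv_R_carrier v] by simp
  moreover have "?w \<bullet> y = v \<bullet> (Q12' *\<^sub>v y)"
    using scalar_prod_mult_mat_vec[OF Q12T v y] by simp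
  moreover have "s \<cdot>\<^sub>m 1\<^sub>m n + Q12' * pinv R * Q12'\<^sup>T \<in> carrier_mat n n" using A by simp
  ultimately show ?thesis
    unfolding Zv qform_complete_square[OF R_sym pinv_R_carrier R_pinv_R y w] Q_eq
    using qform_four_block[OF _ Q12_carrier R_carrier v y] by simp
qed


section \<open>Compatible systems against nonnegativity of the form of \<open>Q\<close>\<close>

abbreviation "\<Sigma> \<equiv> Sigma_D n m T U X \<Phi>"

text \<open>The matrix \<open>[A B]\<close> is written as the transpose of the stacked
  \<open>A\<^sup>T\<close> and \<open>B\<^sup>T\<close>, matching the multiplier in the definition
  of informativity.\<close>

lemma append_rows_mult_D:
  assumes A: "A \<in> carrier_mat n n" and B: "B \<in> carrier_mat n m"
  shows "(A\<^sup>T @\<^sub>r B\<^sup>T)\<^sup>T * D = A * X_minus X + B * U"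
proof -
  let ?M = "A * X_minus X + B * U"
  note Xm = X_minus_carrier
  have AT: "A\<^sup>T \<in> carrier_mat n n" and BT: "B\<^sup>T \<in> carrier_mat m n" using A B by auto
  \<comment> \<open>Row stacking is a block matrix whose right blocks have width 0; after
    transposition the lower blocks have height 0, and the product is formed blockwise with these
    empty blocks.\<close>
  have t0: "(0\<^sub>m k 0 :: real mat)\<^sup>T = 0\<^sub>m 0 k" for k by (intro eq_matI) auto
  have H: "(A\<^sup>T @\<^sub>r B\<^sup>T)\<^sup>T = four_block_mat A B (0\<^sub>m 0 n) (0\<^sub>m 0 m)"
    using transpose_four_block_mat[OF AT zero_carrier_mat[of n 0] BT zero_carrier_mat[of m 0]] A B
    by (simp add: append_rows_def t0)
  have D: "D = four_block_mat (X_minus X) (0\<^sub>m n 0) U (0\<^sub>m m 0)"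
    using Xm U by (simp add: data_stack_def append_rows_def)
  have "(A\<^sup>T @\<^sub>r B\<^sup>T)\<^sup>T * D = four_block_mat ?M (A * 0\<^sub>m n 0 + B * 0\<^sub>m m 0)
    (0\<^sub>m 0 n * X_minus X + 0\<^sub>m 0 m * U) (0\<^sub>m 0 n * 0\<^sub>m n 0 + 0\<^sub>m 0 m * 0\<^sub>m m 0)"
    unfolding H D
    by (rule mult_four_block_mat[OF A B zero_carrier_mat zero_carrier_mat Xm zero_carrier_mat U zero_carrier_mat])
  also have "\<dots> = ?M" using A B Xm U by (intro eq_matI) auto
  finally show ?thesis .
qed

lemma append_rows_carrier:
  "A \<in> carrier_mat n n \<Longrightarrow> B \<in> carrier_mat n m \<Longrightarrow> A\<^sup>T @\<^sub>r B\<^sup>T \<in> carrier_mat (n + m) n"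
  by auto

lemma Sigma_iff:
  assumes A: "A \<in> carrier_mat n n" and B: "B \<in> carrier_mat n m"
  shows "(A, B) \<in> \<Sigma> \<longleftrightarrow> s + (\<Sum>i<n. qform R (row ((A\<^sup>T @\<^sub>r B\<^sup>T)\<^sup>T + Z) i)) \<ge> 0"
  using compatible_iff[of "(A\<^sup>T @\<^sub>r B\<^sup>T)\<^sup>T"] append_rows_carrier[OF A B] append_rows_mult_D[OF A B] A B
  by (simp add: Sigma_D_def)

text \<open>The Frobenius ball lies in the spectral one: with \<open>K = [A B]\<close> and
  \<open>L = K + Z\<close>, the compatibility inequality times the squared norm of \<open>v\<close>
  is a lower bound for the form of \<open>Q\<close>, by
  \<open>qform_transpose_mult_ge\<close>.\<close>

lemma Sigma_imp_qform_Q: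
  assumes AB: "(A, B) \<in> \<Sigma>" and v: "v \<in> carrier_vec n"
  shows "qform Q (v @\<^sub>v (A\<^sup>T @\<^sub>r B\<^sup>T) *\<^sub>v v) \<ge> 0"
proof -
  have A: "A \<in> carrier_mat n n" and B: "B \<in> carrier_mat n m" using AB by (auto simp: Sigma_D_def)
  let ?H = "A\<^sup>T @\<^sub>r B\<^sup>T" let ?L = "?H\<^sup>T + Z"
  have H: "?H \<in> carrier_mat (n + m) n" by (rule append_rows_carrier[OF A B])
  have L: "?L \<in> carrier_mat n (n + m)" using H Z_carrier by simp
  have Hv: "?H *\<^sub>v v \<in> carrier_vec (n + m)" using H v by simp
  have "?L\<^sup>T = ?H + Z\<^sup>T" using H Z_carrier by (intro eq_matI) auto
  then have "?L\<^sup>T *\<^sub>v v = ?H *\<^sub>v v + Z\<^sup>T *\<^sub>v v"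
    using add_mult_distrib_mat_vec[OF H _ v, of "Z\<^sup>T"] Z_carrier by simp
  then have "qform Q (v @\<^sub>v ?H *\<^sub>v v) = s * (v \<bullet> v) + qform R (?L\<^sup>T *\<^sub>v v)"
    using qform_Q[OF v Hv] by simp
  moreover have "(v \<bullet> v) * (s + (\<Sum>i<n. qform R (row ?L i))) \<le> s * (v \<bullet> v) + qform R (?L\<^sup>T *\<^sub>v v)"
    using qform_transpose_mult_ge[OF R_sym qform_R_le L v] by (simp add: distrib_left mult.commute)
  moreover have "(v \<bullet> v) * (s + (\<Sum>i<n. qform R (row ?L i))) \<ge> 0"
    using AB Sigma_iff[OF A B] scalar_prod_self_pos[OF v] by (cases "v = 0\<^sub>v n") auto
  ultimately show ?thesis by linarith
qed

text \<open>For one fixed direction nothing is lost: a rank-one \<open>L\<close> sending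
  \<open>v\<close> to \<open>y + Z\<^sup>T *\<^sub>v v\<close> attains equality in that estimate, so
  \<open>K = L - Z\<close> is compatible and its transpose sends \<open>v\<close> to
  \<open>y\<close>.\<close>

lemma qform_Q_imp_Sigma:
  assumes v: "v \<in> carrier_vec n" "v \<noteq> 0\<^sub>v n" and y: "y \<in> carrier_vec (n + m)"
    and nonneg: "qform Q (v @\<^sub>v y) \<ge> 0"
  obtains A B where "(A, B) \<in> \<Sigma>" "(A\<^sup>T @\<^sub>r B\<^sup>T) *\<^sub>v v = y"
proof -
  have ZT: "Z\<^sup>T \<in> carrier_mat (n + m) n" using Z_carrier by simp
  define z where "z = y + Z\<^sup>T *\<^sub>v v"
  have z: "z \<in> carrier_vec (n + m)" using y ZT v by (simp add: z_def)
  from qform_rank_one[OF R_carrier v z] obtain L where L: "L \<in> carrier_mat n (n + m)"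
    "L\<^sup>T *\<^sub>v v = z" "(v \<bullet> v) * (\<Sum>i<n. qform R (row L i)) = qform R z" .
  \<comment> \<open>\<open>A\<close> takes the first \<open>n\<close> columns of
    \<open>L - Z\<close>, and \<open>B\<close> the remaining \<open>m\<close>.\<close>
  define A where "A = mat n n (\<lambda>(i, j). (L - Z) $$ (i, j))"
  define B where "B = mat n m (\<lambda>(i, j). (L - Z) $$ (i, j + n))"
  have A: "A \<in> carrier_mat n n" and B: "B \<in> carrier_mat n m" by (auto simp: A_def B_def)
  have H: "A\<^sup>T @\<^sub>r B\<^sup>T = L\<^sup>T - Z\<^sup>T"
    using L(1) Z_carrier by (intro eq_matI) (auto simp: append_rows_def A_def B_def)
  have HT: "(A\<^sup>T @\<^sub>r B\<^sup>T)\<^sup>T + Z = L"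
    unfolding H using L(1) Z_carrier by (intro eq_matI) auto
  have "(v \<bullet> v) * (s + (\<Sum>i<n. qform R (row L i))) = qform Q (v @\<^sub>v y)"
    using qform_Q[OF v(1) y] L(3) by (simp add: z_def distrib_left mult.commute)
  then have "s + (\<Sum>i<n. qform R (row L i)) \<ge> 0"
    using nonneg scalar_prod_self_pos[OF v] by (metis zero_le_mult_iff not_le)
  then have "(A, B) \<in> \<Sigma>" unfolding Sigma_iff[OF A B] HT .
  moreover have "(A\<^sup>T @\<^sub>r B\<^sup>T) *\<^sub>v v = z - Z\<^sup>T *\<^sub>v v"
    unfolding H using minus_mult_distrib_mat_vec[OF _ ZT v(1), of "L\<^sup>T"] L by simp
  then have "(A\<^sup>T @\<^sub>r B\<^sup>T) *\<^sub>v v = y"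
    using y ZT v by (auto simp: z_def intro!: eq_vecI)
  ultimately show ?thesis by (rule that)
qed

end

section \<open>Informativity and the matrix inequality\<close>

abbreviation lyap_block :: "nat \<Rightarrow> real mat \<Rightarrow> real mat" where
  "lyap_block m P \<equiv> diag_block_mat [P, - P, 1\<^sub>m m]"

lemma append_rows_one_mult:
  assumes H: "(H :: real mat) \<in> carrier_mat q n" and v: "v \<in> carrier_vec n"
  shows "(1\<^sub>m n @\<^sub>r H) *\<^sub>v v = v @\<^sub>v H *\<^sub>v v"
  using mat_mult_append[OF one_carrier_mat H v] v by simp

text \<open>The first diagonal block \<open>S\<close> is kept separate from \<open>P\<close> to
  cover both \<open>P\<close> itself and
  \<open>P - \<beta> \<cdot>\<^sub>m 1\<^sub>m n\<close>.\<close>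

lemma
  assumes P: "P \<in> sym_mats n" and S: "S \<in> sym_mats n"
  shows sym_mats_lyap: "diag_block_mat [S, - P, 1\<^sub>m m] \<in> sym_mats (n + (n + m))"
    and qform_lyap: "v \<in> carrier_vec n \<Longrightarrow> y \<in> carrier_vec (n + m) \<Longrightarrow>
      qform (diag_block_mat [S, - P, 1\<^sub>m m]) (v @\<^sub>v y) =
      qform S v + qform (diag_block_mat [- P, 1\<^sub>m m]) y"
proof -
  have PI: "diag_block_mat [- P, 1\<^sub>m m] \<in> sym_mats (n + m)"
    by (intro sym_mats_diag_block sym_mats_uminus P sym_mats_one)
  then show "diag_block_mat [S, - P, 1\<^sub>m m] \<in> sym_mats (n + (n + m))"
    by (subst diag_block_mat_Cons) (rule sym_mats_diag_block[OF S])
  show "qform (diag_block_mat [S, - P, 1\<^sub>m m]) (v @\<^sub>v y) =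
      qform S v + qform (diag_block_mat [- P, 1\<^sub>m m]) y"
    if "v \<in> carrier_vec n" "y \<in> carrier_vec (n + m)"
    using S PI that
    by (subst diag_block_mat_Cons, intro qform_diag_block[of _ n _ "n + m"]) (auto simp: sym_mats_def)
qed

lemma scalar_prod_append_self:
  assumes "v \<in> carrier_vec n" "y \<in> carrier_vec q"
  shows "(v @\<^sub>v y) \<bullet> (v @\<^sub>v y) = v \<bullet> v + y \<bullet> (y :: real vec)"
  using scalar_prod_append[OF assms assms] .

context noisy_data
begin

text \<open>The congruence factor maps \<open>v\<close> to \<open>v\<close> followed by its image
  under the transpose of \<open>[A B]\<close>, so definiteness is positivity of the block form on
  that graph.\<close>

lemma lyap_pd_iff:
  assumes P: "P \<in> sym_mats n" and AB: "(A, B) \<in> \<Sigma>"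
  shows "pd n ((1\<^sub>m n @\<^sub>r A\<^sup>T @\<^sub>r B\<^sup>T)\<^sup>T * lyap_block m P * (1\<^sub>m n @\<^sub>r A\<^sup>T @\<^sub>r B\<^sup>T)) \<longleftrightarrow>
    (\<forall>v \<in> carrier_vec n. v \<noteq> 0\<^sub>v n \<longrightarrow> qform (lyap_block m P) (v @\<^sub>v (A\<^sup>T @\<^sub>r B\<^sup>T) *\<^sub>v v) > 0)"
proof -
  let ?H = "A\<^sup>T @\<^sub>r B\<^sup>T" let ?F = "1\<^sub>m n @\<^sub>r ?H" let ?M = "lyap_block m P"
  have H: "?H \<in> carrier_mat (n + m) n"
    using AB by (intro append_rows_carrier) (auto simp: Sigma_D_def)
  have F: "?F \<in> carrier_mat (n + (n + m)) n" using H by auto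
  have M: "?M \<in> sym_mats (n + (n + m))" by (rule sym_mats_lyap[OF P P])
  have "v \<bullet> ((?F\<^sup>T * ?M * ?F) *\<^sub>v v) = qform ?M (v @\<^sub>v ?H *\<^sub>v v)" if "v \<in> carrier_vec n" for v
    using qform_congruence[OF F _ that, of ?M] M append_rows_one_mult[OF H that]
    by (simp add: qform_def sym_mats_def)
  then show ?thesis using sym_mats_congruence[OF F M] by (auto simp: pd_def)
qed

text \<open>By \<open>qform_Q_imp_Sigma\<close> every nonzero point where the form of
  \<open>Q\<close> is nonnegative lies on the graph of a compatible system, so informativity is the
  premise of the strict S-lemma. Its surplus \<delta> becomes \<beta>.\<close>

lemma informative_imp_LMI:
  assumes n: "n > 0" and true: "(A\<^sub>s, B\<^sub>s) \<in> \<Sigma>" and P: "P \<in> sym_mats n"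
    and stab: "\<forall>A B. (A, B) \<in> \<Sigma> \<longrightarrow> (\<forall>v \<in> carrier_vec n. v \<noteq> 0\<^sub>v n \<longrightarrow>
      qform (lyap_block m P) (v @\<^sub>v (A\<^sup>T @\<^sub>r B\<^sup>T) *\<^sub>v v) > 0)"
  obtains \<alpha> \<beta> where "\<alpha> \<ge> 0" "\<beta> > 0"
    "psd (n + (n + m)) (diag_block_mat [P - \<beta> \<cdot>\<^sub>m 1\<^sub>m n, - P, 1\<^sub>m m] - \<alpha> \<cdot>\<^sub>m Q)"
proof -
  let ?M = "lyap_block m P" and ?k = "n + (n + m)"
  have M: "?M \<in> carrier_mat ?k ?k" and Q: "Q \<in> carrier_mat ?k ?k"
    using sym_mats_lyap[OF P P] Q_sym by (auto simp: sym_mats_def)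
  have split: "\<exists>v\<in>carrier_vec n. \<exists>y\<in>carrier_vec (n + m). x = v @\<^sub>v y"
    if "x \<in> carrier_vec ?k" for x :: "real vec"
    using that vec_first_last_append[of x n "n + m"] vec_first_carrier vec_last_carrier by metis
  have pos: "qform ?M x > 0" if x: "x \<in> carrier_vec ?k" "x \<noteq> 0\<^sub>v ?k" "qform Q x \<ge> 0" for x
  proof -
    obtain v y where vy: "v \<in> carrier_vec n" "y \<in> carrier_vec (n + m)" "x = v @\<^sub>v y"
      using split[OF x(1)] by blast
    \<comment> \<open>At \<open>v = 0\<close> the form of \<open>Q\<close> reduces to that of the
      negative definite \<open>R\<close>, so \<open>y\<close> and hence \<open>x\<close> would
      vanish.\<close>
    have "v \<noteq> 0\<^sub>v n"
    proof
      assume v0: "v = 0\<^sub>v n"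
      have "Z\<^sup>T *\<^sub>v v = 0\<^sub>v (n + m)" using Z_carrier v0 by (intro eq_vecI) auto
      then have "qform R y \<ge> 0" using x(3) qform_Q[OF vy(1,2)] vy v0 by simp
      then have "y = 0\<^sub>v (n + m)" using qform_R_neg[OF vy(2)] by force
      then show False using x(2) vy(3) v0 by auto
    qed
    from qform_Q_imp_Sigma[OF vy(1) this vy(2)] x(3) vy(3) obtain A B
      where "(A, B) \<in> \<Sigma>" "(A\<^sup>T @\<^sub>r B\<^sup>T) *\<^sub>v v = y" by blast
    then show ?thesis using stab vy \<open>v \<noteq> 0\<^sub>v n\<close> by blast
  qed
  \<comment> \<open>The true system supplies the nonzero point with nonnegative form of
    \<open>Q\<close> that the strict S-lemma asks for; its entry 0 equals 1 because
    \<open>n > 0\<close>.\<close>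
  let ?e = "unit_vec n 0 :: real vec"
  let ?x = "?e @\<^sub>v (A\<^sub>s\<^sup>T @\<^sub>r B\<^sub>s\<^sup>T) *\<^sub>v ?e"
  have As: "A\<^sub>s\<^sup>T @\<^sub>r B\<^sub>s\<^sup>T \<in> carrier_mat (n + m) n"
    using true by (intro append_rows_carrier) (auto simp: Sigma_D_def)
  have x: "?x \<in> carrier_vec ?k"
    by (intro append_carrier_vec unit_vec_carrier mult_mat_vec_carrier[OF As])
  have "?x $ 0 = 1" using n by simp
  then have x0: "?x \<noteq> 0\<^sub>v ?k" using n by (metis add_gr_0 index_zero_vec(1) zero_neq_one)
  have xQ: "qform Q ?x \<ge> 0" by (rule Sigma_imp_qform_Q[OF true unit_vec_carrier])
  from strict_S_lemma[OF M Q pos x x0 xQ] obtain \<alpha> \<delta>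
    where \<alpha>: "\<alpha> \<ge> 0" and \<delta>: "\<delta> > 0"
      and ineq: "\<And>x. x \<in> carrier_vec ?k \<Longrightarrow> qform ?M x - \<alpha> * qform Q x \<ge> \<delta> * (x \<bullet> x)" by blast
  let ?P' = "P - \<delta> \<cdot>\<^sub>m 1\<^sub>m n" let ?M' = "diag_block_mat [?P', - P, 1\<^sub>m m]"
  have P': "?P' \<in> sym_mats n" by (intro sym_mats_minus sym_mats_smult P sym_mats_one)
  have M': "?M' \<in> sym_mats ?k" by (rule sym_mats_lyap[OF P P'])
  have "qform (?M' - \<alpha> \<cdot>\<^sub>m Q) x \<ge> 0" if x: "x \<in> carrier_vec ?k" for x
  proof -
    obtain v y where vy: "v \<in> carrier_vec n" "y \<in> carrier_vec (n + m)" "x = v @\<^sub>v y"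
      using split[OF x] by blast
    have "qform ?P' v = qform P v - \<delta> * (v \<bullet> v)"
      using P vy(1) by (simp add: qform_minus[of _ n] qform_smult_mat[of _ n] qform_one sym_mats_def)
    then have "qform ?M' x = qform ?M x - \<delta> * (v \<bullet> v)"
      unfolding vy(3) qform_lyap[OF P P' vy(1,2)] qform_lyap[OF P P vy(1,2)] by simp
    moreover have "qform (?M' - \<alpha> \<cdot>\<^sub>m Q) x = qform ?M' x - \<alpha> * qform Q x"
      using M' Q x by (subst qform_minus[of _ ?k]) (auto simp: qform_smult_mat[of _ ?k] sym_mats_def)
    \<comment> \<open>Only the \<open>v\<close> part of the surplus is kept, since \<beta> appears
      in the first block alone.\<close>
    moreover have "\<delta> * (x \<bullet> x) \<ge> \<delta> * (v \<bullet> v)"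
      using \<delta> vy scalar_prod_append_self[OF vy(1,2)] scalar_prod_self_pos[OF vy(2)]
      by (cases "y = 0\<^sub>v (n + m)") auto
    ultimately show ?thesis using ineq[OF x] by linarith
  qed
  then have "psd ?k (?M' - \<alpha> \<cdot>\<^sub>m Q)"
    using sym_mats_minus[OF M' sym_mats_smult[OF Q_sym]] by (simp add: psd_def qform_def)
  then show ?thesis by (rule that[OF \<alpha> \<delta>])
qed

text \<open>On the graph of a compatible system the form of \<open>Q\<close> is nonnegative, so the
  matrix inequality leaves at least \<beta> times the squared norm of \<open>v\<close>.\<close>

lemma LMI_imp_informative:
  assumes P: "P \<in> sym_mats n" and \<alpha>: "\<alpha> \<ge> 0" and \<beta>: "\<beta> > 0"
    and LMI: "psd (n + (n + m)) (diag_block_mat [P - \<beta> \<cdot>\<^sub>m 1\<^sub>m n, - P, 1\<^sub>m m] - \<alpha> \<cdot>\<^sub>m Q)"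
    and AB: "(A, B) \<in> \<Sigma>" and v: "v \<in> carrier_vec n" "v \<noteq> 0\<^sub>v n"
  shows "qform (lyap_block m P) (v @\<^sub>v (A\<^sup>T @\<^sub>r B\<^sup>T) *\<^sub>v v) > 0"
proof -
  let ?k = "n + (n + m)" let ?P' = "P - \<beta> \<cdot>\<^sub>m 1\<^sub>m n" let ?M' = "diag_block_mat [?P', - P, 1\<^sub>m m]"
  let ?y = "(A\<^sup>T @\<^sub>r B\<^sup>T) *\<^sub>v v" let ?x = "v @\<^sub>v ?y"
  have "A\<^sup>T @\<^sub>r B\<^sup>T \<in> carrier_mat (n + m) n"
    using AB by (intro append_rows_carrier) (auto simp: Sigma_D_def)
  then have y: "?y \<in> carrier_vec (n + m)" using v by simp
  then have x: "?x \<in> carrier_vec ?k" using v by simp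
  have P': "?P' \<in> sym_mats n" by (intro sym_mats_minus sym_mats_smult P sym_mats_one)
  have M': "?M' \<in> sym_mats ?k" by (rule sym_mats_lyap[OF P P'])
  have "qform ?P' v = qform P v - \<beta> * (v \<bullet> v)"
    using P v by (simp add: qform_minus[of _ n] qform_smult_mat[of _ n] qform_one sym_mats_def)
  then have "qform (lyap_block m P) ?x = qform ?M' ?x + \<beta> * (v \<bullet> v)"
    unfolding qform_lyap[OF P P' v(1) y] qform_lyap[OF P P v(1) y] by simp
  moreover have "qform (?M' - \<alpha> \<cdot>\<^sub>m Q) ?x = qform ?M' ?x - \<alpha> * qform Q ?x"
    using M' Q_sym x by (subst qform_minus[of _ ?k]) (auto simp: qform_smult_mat[of _ ?k] sym_mats_def)
  moreover have "qform (?M' - \<alpha> \<cdot>\<^sub>m Q) ?x \<ge> 0" using LMI x by (simp add: psd_def qform_def)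
  moreover have "\<alpha> * qform Q ?x \<ge> 0" using \<alpha> Sigma_imp_qform_Q[OF AB v(1)] by simp
  moreover have "\<beta> * (v \<bullet> v) > 0" using \<beta> scalar_prod_self_pos[OF v] by simp
  ultimately show ?thesis by linarith
qed

end

theorem theorem7:
  fixes n m T :: nat and U X \<Phi> \<phi> A\<^sub>s B\<^sub>s :: "real mat"
  assumes "n > 0" and "m > 0" and "T > 0"
    and "U \<in> carrier_mat m T" and "X \<in> carrier_mat n (T + 1)"
    and "\<Phi> \<in> Pi_set 1 (n * T)"
    and "\<phi> \<in> sym_mats T" and "blk22 1 \<Phi> = kron \<phi> (1\<^sub>m n)"
    and "(A\<^sub>s, B\<^sub>s) \<in> Sigma_D n m T U X \<Phi>"
    and "pd T (- \<phi>)"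
    and "vec_space.rank (n + m) (data_stack U X) = n + m"
  shows "informative_quad_stab n m T U X \<Phi> \<longleftrightarrow>
    (\<exists>P \<alpha> \<beta>. pd n P \<and> \<alpha> \<ge> 0 \<and> \<beta> > 0 \<and>
      psd (n + (n + m))
        (diag_block_mat [P - \<beta> \<cdot>\<^sub>m 1\<^sub>m n, - P, 1\<^sub>m m] - \<alpha> \<cdot>\<^sub>m Q_mat n m T U X \<Phi> \<phi>))"
proof -
  have \<Phi>: "\<Phi> \<in> sym_mats (1 + n * T)" using assms(6) by (simp add: Pi_set_def)
  interpret noisy_data n m T U X \<Phi> \<phi>
    by (rule noisy_data.intro[OF assms(4,5) \<Phi> assms(7,8,10,11)])
  \<comment> \<open>Informativity as positivity of one quadratic form, the shape used by both
    implications.\<close>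
  have inf: "informative_quad_stab n m T U X \<Phi> \<longleftrightarrow>
    (\<exists>P. pd n P \<and> (\<forall>A B. (A, B) \<in> \<Sigma> \<longrightarrow> (\<forall>v \<in> carrier_vec n. v \<noteq> 0\<^sub>v n \<longrightarrow>
      qform (lyap_block m P) (v @\<^sub>v (A\<^sup>T @\<^sub>r B\<^sup>T) *\<^sub>v v) > 0)))"
  proof -
    have "(\<forall>(A, B) \<in> \<Sigma>. pd n ((1\<^sub>m n @\<^sub>r A\<^sup>T @\<^sub>r B\<^sup>T)\<^sup>T * lyap_block m P * (1\<^sub>m n @\<^sub>r A\<^sup>T @\<^sub>r B\<^sup>T))) \<longleftrightarrow>
      (\<forall>A B. (A, B) \<in> \<Sigma> \<longrightarrow> (\<forall>v \<in> carrier_vec n. v \<noteq> 0\<^sub>v n \<longrightarrow>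
        qform (lyap_block m P) (v @\<^sub>v (A\<^sup>T @\<^sub>r B\<^sup>T) *\<^sub>v v) > 0))" if "pd n P" for P
    proof -
      have "P \<in> sym_mats n" using that by (simp add: pd_def)
      note iff = lyap_pd_iff[OF this]
      show ?thesis unfolding Ball_def split_paired_All prod.case using iff unfolding Ball_def by blast
    qed
    then show ?thesis unfolding informative_quad_stab_def by blast
  qed
  show ?thesis
  proof
    assume "informative_quad_stab n m T U X \<Phi>"
    then obtain P where P: "pd n P" and stab: "\<forall>A B. (A, B) \<in> \<Sigma> \<longrightarrow> (\<forall>v \<in> carrier_vec n. v \<noteq> 0\<^sub>v n \<longrightarrow>
      qform (lyap_block m P) (v @\<^sub>v (A\<^sup>T @\<^sub>r B\<^sup>T) *\<^sub>v v) > 0)"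
      unfolding inf by blast
    have "P \<in> sym_mats n" using P by (simp add: pd_def)
    then obtain \<alpha> \<beta> where "\<alpha> \<ge> 0" "\<beta> > 0"
      "psd (n + (n + m)) (diag_block_mat [P - \<beta> \<cdot>\<^sub>m 1\<^sub>m n, - P, 1\<^sub>m m] - \<alpha> \<cdot>\<^sub>m Q)"
      by (rule informative_imp_LMI[OF assms(1,9) _ stab])
    then show "\<exists>P \<alpha> \<beta>. pd n P \<and> \<alpha> \<ge> 0 \<and> \<beta> > 0 \<and>
      psd (n + (n + m)) (diag_block_mat [P - \<beta> \<cdot>\<^sub>m 1\<^sub>m n, - P, 1\<^sub>m m] - \<alpha> \<cdot>\<^sub>m Q)"
      by (intro exI[of _ P] exI[of _ \<alpha>] exI[of _ \<beta>] conjI P)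
  next
    assume "\<exists>P \<alpha> \<beta>. pd n P \<and> \<alpha> \<ge> 0 \<and> \<beta> > 0 \<and>
      psd (n + (n + m)) (diag_block_mat [P - \<beta> \<cdot>\<^sub>m 1\<^sub>m n, - P, 1\<^sub>m m] - \<alpha> \<cdot>\<^sub>m Q)"
    then obtain P \<alpha> \<beta> where P: "pd n P" and LMI: "\<alpha> \<ge> 0" "\<beta> > 0"
      "psd (n + (n + m)) (diag_block_mat [P - \<beta> \<cdot>\<^sub>m 1\<^sub>m n, - P, 1\<^sub>m m] - \<alpha> \<cdot>\<^sub>m Q)" by blast
    have "P \<in> sym_mats n" using P by (simp add: pd_def)
    note stab = LMI_imp_informative[OF this LMI]
    show "informative_quad_stab n m T U X \<Phi>"
      unfolding inf by (intro exI[of _ P] conjI P allI impI ballI stab)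
  qed
qed

end
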